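(* Let $E$ be a Banach lattice and let $B\subset B_{E^*}$ be an absolutely boundary of $B_{E^*}$. If $K\subset E$ is norm-bounded and sequentially $|\sigma|(E,B)$-compact, then $K$ is absolutely weakly sequentially compact. Moreover, if $E$ is separable or $B_{E^{**}}$ is absolutely weak$^*$ compact, then $K$ is absolutely weakly compact.
   Context: Banach lattices are real; $B_X$ denotes the closed unit ball of $X$. For a Banach lattice $E$, a set $B\subset B_{E^*}$ is an absolutely boundary of $B_{E^*}$ (also called an absolutely James boundary of $E$) if for every $x\in E$ there exists $x_0^*\in B$ such that $|x_0^*|(|x|)=\sup_{x^*\in B_{E^*}}|x^*|(|x|)$. For a nonempty $A\subset E^*$, $|\sigma|(E,A)$ is the locally convex-solid topology on $E$ generated by the lattice seminorms $p_{x^*}(x)=|x^*|(|x|)$, $x^*\in A$. The absolute weak topology of $E$ is $|\sigma|(E,E^* )$. A set $K\subset E$ is sequentially $|\sigma|(E,A)$-compact if every sequence in $K$ has a subsequence converging in $|\sigma|(E,A)$ to an element of $K$; "absolutely weakly sequentially compact" means sequentially $|\sigma|(E,E^* )$-compact, and "absolutely weakly compact" means $|\sigma|(E,E^* )$-compact. The absolute weak$^*$ topology on $E^{**}$ is $|\sigma|(E^{**},E^* )$, generated by the seminorms $x^{**}\mapsto |x^{**}|(|x^*|)$, $x^*\in E^*$; "absolutely weak$^*$ compact" means compact for this topology. *)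

theory Defs
  imports "HOL-Analysis.Analysis" "HOL-Library.Lattice_Algebras"
begin

section \<open>Banach lattices\<close>

class banach_lattice = banach + ordered_real_vector + lattice_ab_group_add_abs +
  assumes norm_mono_abs: "\<bar>x\<bar> \<le> \<bar>y\<bar> \<Longrightarrow> norm x \<le> norm y"

instance real :: banach_lattice
  by standard auto

lemma norm_abs_banach_lattice [simp]: "norm \<bar>x\<bar> = norm x" for x :: "'a::banach_lattice"
  by (simp add: norm_mono_abs order_antisym)

lemma norm_mono_nonneg: "0 \<le> x \<Longrightarrow> x \<le> y \<Longrightarrow> norm x \<le> norm y" for x y :: "'a::banach_lattice"
  by (rule norm_mono_abs) (simp add: order_trans[of 0 x y])


section \<open>The dual of a Banach lattice is a Banach lattice\<close>

subsection \<open>Totally ordered Banach lattices\<close>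

text \<open>
  Type class arities only constrain the codomain of \<open>'a \<Rightarrow>\<^sub>L 'b\<close> by a sort, so the lattice
  structure of the dual \<open>'a \<Rightarrow>\<^sub>L real\<close> is introduced for totally ordered codomains.
  A totally ordered Banach lattice has dimension at most one, hence no generality is gained
  or lost.
\<close>

definition signed_norm :: "'b::{banach_lattice,linorder} \<Rightarrow> real" where
  "signed_norm y = (if 0 \<le> y then norm y else - norm y)"

lemma linorder_archimedean:
  fixes u d :: "'b::{banach_lattice,linorder}"
  assumes "0 < d" "0 \<le> u"
  obtains n :: nat where "0 < n" "(1 / real n) *\<^sub>R u \<le> d"
proof -
  obtain n :: nat where n: "norm u / norm d < real n"
    using reals_Archimedean2 by blast
  have nd: "0 < norm d" using assms by simp
  have n0: "0 < n" using n nd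
    by (metis divide_nonneg_pos norm_ge_zero not_less of_nat_0_less_iff order_less_le_trans of_nat_le_0_iff gr0I of_nat_0)
  have "u \<le> real n *\<^sub>R d"
  proof (rule ccontr)
    assume "\<not> ?thesis"
    then have "real n *\<^sub>R d \<le> u" by simp
    moreover have "0 \<le> real n *\<^sub>R d" using assms by (simp add: scaleR_nonneg_nonneg)
    ultimately have "norm (real n *\<^sub>R d) \<le> norm u" by (intro norm_mono_nonneg)
    then show False using n nd by (simp add: field_simps)
  qed
  then have "(1 / real n) *\<^sub>R u \<le> (1 / real n) *\<^sub>R (real n *\<^sub>R d)"
    by (intro scaleR_left_mono) auto
  then show ?thesis using n0 that by simp
qed

lemma linorder_unit_nonneg:
  fixes u y :: "'b::{banach_lattice,linorder}"
  assumes u: "0 \<le> u" "norm u = 1" and y: "0 \<le> y"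
  shows "y = norm y *\<^sub>R u"
proof (rule ccontr)
  assume neq: "y \<noteq> norm y *\<^sub>R u"
  consider "y < norm y *\<^sub>R u" | "norm y *\<^sub>R u < y" using neq by fastforce
  then show False
  proof cases
    case 1
    then have "0 < norm y *\<^sub>R u - y" by simp
    then obtain n :: nat where n: "0 < n" "(1 / real n) *\<^sub>R u \<le> norm y *\<^sub>R u - y"
      using linorder_archimedean u by blast
    then have le: "y \<le> (norm y - 1 / real n) *\<^sub>R u"
      by (simp add: algebra_simps)
    show False
    proof (cases "0 \<le> norm y - 1 / real n")
      case True
      have "norm y \<le> norm ((norm y - 1 / real n) *\<^sub>R u)" using y le by (rule norm_mono_nonneg)
      then show False using True u n by simp
    next
      case False
      then have "(norm y - 1 / real n) *\<^sub>R u \<le> 0"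
        using u by (simp add: scaleR_nonpos_nonneg)
      then have "y = 0" using le y by simp
      then show False using 1 by simp
    qed
  next
    case 2
    then have "0 < y - norm y *\<^sub>R u" by simp
    then obtain n :: nat where n: "0 < n" "(1 / real n) *\<^sub>R u \<le> y - norm y *\<^sub>R u"
      using linorder_archimedean u by blast
    then have le: "(norm y + 1 / real n) *\<^sub>R u \<le> y"
      by (simp add: algebra_simps)
    have "0 \<le> (norm y + 1 / real n) *\<^sub>R u" using u by (simp add: scaleR_nonneg_nonneg)
    then have "norm ((norm y + 1 / real n) *\<^sub>R u) \<le> norm y" using le by (rule norm_mono_nonneg)
    then have "norm y + 1 / real n \<le> norm y" using u by simp
    then show False using n by simp
  qed
qed

lemma signed_norm_repr:
  obtains u :: "'b::{banach_lattice,linorder}"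
  where "0 \<le> u" "norm u \<le> 1" "\<And>y. y = signed_norm y *\<^sub>R u" "\<And>r. u \<noteq> 0 \<Longrightarrow> signed_norm (r *\<^sub>R u) = r"
proof (cases "\<forall>y::'b. y = 0")
  case True
  then show ?thesis using that[of 0] by auto
next
  case False
  then obtain v :: 'b where v: "v \<noteq> 0" by blast
  define u where "u = (1 / norm v) *\<^sub>R \<bar>v\<bar>"
  have u: "0 \<le> u" "norm u = 1" using v by (auto simp: u_def intro!: scaleR_nonneg_nonneg)
  have repr: "y = signed_norm y *\<^sub>R u" for y
  proof (cases "0 \<le> y")
    case True
    then show ?thesis using linorder_unit_nonneg[OF u] by (simp add: signed_norm_def)
  next
    case False
    then have "- y = norm (- y) *\<^sub>R u" by (intro linorder_unit_nonneg[OF u]) simp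
    then show ?thesis using False by (simp add: signed_norm_def neg_equal_iff_equal[of y, symmetric])
  qed
  have "signed_norm (r *\<^sub>R u) = r" for r
    using repr[of "r *\<^sub>R u"] u by force
  then show ?thesis using that[of u] u repr by simp
qed

lemma signed_norm_add: "signed_norm (x + y) = signed_norm x + signed_norm y"
  and signed_norm_scaleR: "signed_norm (r *\<^sub>R x) = r * signed_norm x"
  and signed_norm_le_iff: "signed_norm x \<le> signed_norm y \<longleftrightarrow> x \<le> y"
  and abs_signed_norm: "\<bar>signed_norm x\<bar> = norm x"
  for x y :: "'b::{banach_lattice,linorder}"
proof -
  obtain u :: 'b where u: "0 \<le> u" "\<And>y. y = signed_norm y *\<^sub>R u"
      "\<And>r. u \<noteq> 0 \<Longrightarrow> signed_norm (r *\<^sub>R u) = r"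
    using signed_norm_repr by metis
  show "\<bar>signed_norm x\<bar> = norm x" by (simp add: signed_norm_def)
  consider "u = 0" | "u \<noteq> 0" by blast
  then have "signed_norm (x + y) = signed_norm x + signed_norm y \<and>
    signed_norm (r *\<^sub>R x) = r * signed_norm x \<and>
    (signed_norm x \<le> signed_norm y \<longleftrightarrow> x \<le> y)"
  proof cases
    case 1
    then have "z = 0" for z :: 'b using u(2)[of z] by simp
    then have z: "x = 0" "y = 0" by auto
    show ?thesis unfolding z by (simp add: signed_norm_def)
  next
    case 2
    have "x + y = (signed_norm x + signed_norm y) *\<^sub>R u"
      using u(2)[of x] u(2)[of y] by (simp add: scaleR_add_left)
    moreover have "r *\<^sub>R x = (r * signed_norm x) *\<^sub>R u"
      using u(2)[of x] by (metis scaleR_scaleR)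
    moreover have "x \<le> y" if "signed_norm x \<le> signed_norm y"
      using scaleR_right_mono[OF that u(1)] u(2)[of x] u(2)[of y] by simp
    moreover have "signed_norm x \<le> signed_norm y" if "x \<le> y"
    proof (rule ccontr)
      assume less: "\<not> ?thesis"
      then have "signed_norm y *\<^sub>R u \<le> signed_norm x *\<^sub>R u"
        using u(1) by (intro scaleR_right_mono) auto
      then have "y \<le> x" using u(2)[of x] u(2)[of y] by simp
      with that have "x = y" by simp
      with less show False by simp
    qed
    ultimately show ?thesis using u(3)[OF 2] by metis
  qed
  then show "signed_norm (x + y) = signed_norm x + signed_norm y"
    "signed_norm (r *\<^sub>R x) = r * signed_norm x"
    "signed_norm x \<le> signed_norm y \<longleftrightarrow> x \<le> y" by auto
qed


subsection \<open>The Riesz--Kantorovich modulus\<close>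

lemma riesz_decomposition:
  fixes y :: "'a::lattice_ab_group_add_abs"
  assumes y: "\<bar>y\<bar> \<le> a + b" and a: "0 \<le> a" and b: "0 \<le> b"
  obtains y1 y2 where "y = y1 + y2" "\<bar>y1\<bar> \<le> a" "\<bar>y2\<bar> \<le> b"
proof
  define y1 where "y1 = inf (sup y (- a)) a"
  have y': "y \<le> a + b" "- (a + b) \<le> y" using abs_le_D1[OF y] abs_le_D2[OF y] minus_le_iff by blast+
  show "y = y1 + (y - y1)" by simp
  have aa: "- a \<le> a" using a by (meson neg_le_0_iff_le order_trans)
  show "\<bar>y1\<bar> \<le> a"
    by (rule abs_leI) (auto simp: y1_def minus_le_iff aa simp del: neg_inf_eq_sup neg_sup_eq_inf)
  have "y \<le> y1 + b"
  proof -
    have "y - b \<le> sup y (- a)" using b by (simp add: le_supI1 add_increasing2 diff_le_eq)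
    moreover have "y - b \<le> a" using y' by (simp add: diff_le_eq)
    ultimately have "y - b \<le> y1" by (simp add: y1_def)
    then show ?thesis by (simp add: diff_le_eq)
  qed
  moreover have "y1 \<le> y + b"
  proof -
    have "- a \<le> y + b" using y' by (metis add.commute diff_le_eq minus_add_distrib uminus_add_conv_diff diff_conv_add_uminus)
    then have "sup y (- a) \<le> y + b" using b by (simp add: add_increasing2)
    then show ?thesis by (simp add: y1_def le_infI1)
  qed
  ultimately show "\<bar>y - y1\<bar> \<le> b"
    by (intro abs_leI) (auto simp: diff_le_eq add.commute)
qed

lemma abs_scaleR_nonneg:
  fixes y :: "'a::banach_lattice"
  assumes "0 \<le> r"
  shows "\<bar>r *\<^sub>R y\<bar> \<le> r *\<^sub>R \<bar>y\<bar>"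
  using assms by (intro abs_leI) (auto simp flip: scaleR_minus_right intro!: scaleR_left_mono abs_ge_self abs_ge_minus_self)

definition riesz_abs :: "('a::banach_lattice \<Rightarrow> real) \<Rightarrow> 'a \<Rightarrow> real" where
  "riesz_abs F x = (SUP y\<in>{y. \<bar>y\<bar> \<le> x}. F y)"

lemma riesz_abs_props:
  fixes F :: "'a::banach_lattice \<Rightarrow> real"
  assumes F: "bounded_linear F" and K: "\<And>x. \<bar>F x\<bar> \<le> K * norm x"
  shows riesz_abs_upper: "\<bar>y\<bar> \<le> x \<Longrightarrow> F y \<le> riesz_abs F x"
    and riesz_abs_least: "0 \<le> x \<Longrightarrow> (\<And>y. \<bar>y\<bar> \<le> x \<Longrightarrow> F y \<le> c) \<Longrightarrow> riesz_abs F x \<le> c"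
    and riesz_abs_bound: "0 \<le> x \<Longrightarrow> riesz_abs F x \<le> K * norm x"
    and riesz_abs_nonneg: "0 \<le> x \<Longrightarrow> 0 \<le> riesz_abs F x"
    and riesz_abs_add: "0 \<le> a \<Longrightarrow> 0 \<le> b \<Longrightarrow> riesz_abs F (a + b) = riesz_abs F a + riesz_abs F b"
    and riesz_abs_scaleR: "0 \<le> a \<Longrightarrow> 0 \<le> r \<Longrightarrow> riesz_abs F (r *\<^sub>R a) = r * riesz_abs F a"
proof -
  interpret bounded_linear F by fact
  have K0: "0 \<le> K * norm x" for x :: 'a
    using abs_ge_zero[of "F x"] K[of x] by linarith
  have bnd: "F y \<le> K * norm x" if "\<bar>y\<bar> \<le> x" for x y
  proof -
    have "norm y \<le> norm x" using norm_mono_nonneg[OF abs_ge_zero that] by simp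
    moreover have "F y \<le> K * norm y" using K[of y] by simp
    moreover have "K * norm y \<le> K * norm x" if "0 \<le> K"
      using that \<open>norm y \<le> norm x\<close> by (rule mult_left_mono[rotated])
    moreover have "norm y = 0 \<and> norm x = 0" if "\<not> 0 \<le> K"
      using that K0[of x] K0[of y] by (auto simp: zero_le_mult_iff)
    ultimately show ?thesis by fastforce
  qed
  show upper: "F y \<le> riesz_abs F x" if "\<bar>y\<bar> \<le> x" for x y
    unfolding riesz_abs_def using that bnd by (intro cSUP_upper bdd_aboveI2) auto
  show least: "riesz_abs F x \<le> c" if "0 \<le> x" "\<And>y. \<bar>y\<bar> \<le> x \<Longrightarrow> F y \<le> c" for x c
    unfolding riesz_abs_def
  proof (rule cSUP_least)
    show "{y. \<bar>y\<bar> \<le> x} \<noteq> {}" using that(1) by (intro ex_in_conv[THEN iffD1] exI[of _ 0]) simp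
  qed (use that(2) in auto)
  show "riesz_abs F x \<le> K * norm x" if "0 \<le> x" for x
    using that bnd by (intro least)
  show "0 \<le> riesz_abs F x" if "0 \<le> x" for x
    using upper[of 0 x] that by (simp add: zero)
  show "riesz_abs F (a + b) = riesz_abs F a + riesz_abs F b" if ab: "0 \<le> a" "0 \<le> b" for a b
  proof (rule antisym)
    show "riesz_abs F (a + b) \<le> riesz_abs F a + riesz_abs F b"
    proof (rule least)
      fix y assume "\<bar>y\<bar> \<le> a + b"
      then obtain y1 y2 where "y = y1 + y2" "\<bar>y1\<bar> \<le> a" "\<bar>y2\<bar> \<le> b"
        using riesz_decomposition ab by blast
      then show "F y \<le> riesz_abs F a + riesz_abs F b"
        using upper[of y1 a] upper[of y2 b] by (simp add: add)
    qed (use ab in simp)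
    have step: "F y1 + F y2 \<le> riesz_abs F (a + b)" if "\<bar>y1\<bar> \<le> a" "\<bar>y2\<bar> \<le> b" for y1 y2
    proof -
      have "\<bar>y1 + y2\<bar> \<le> a + b" using that by (meson abs_triangle_ineq add_mono order_trans)
      then show ?thesis using upper by (simp flip: add)
    qed
    have "riesz_abs F b \<le> riesz_abs F (a + b) - F y1" if "\<bar>y1\<bar> \<le> a" for y1
      using ab step[OF that] by (intro least) (auto simp: le_diff_eq add.commute)
    then have "F y1 \<le> riesz_abs F (a + b) - riesz_abs F b" if "\<bar>y1\<bar> \<le> a" for y1
      using that by fastforce
    then have "riesz_abs F a \<le> riesz_abs F (a + b) - riesz_abs F b"
      by (rule least[OF ab(1)])
    then show "riesz_abs F a + riesz_abs F b \<le> riesz_abs F (a + b)" by simp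
  qed
  have le: "r * riesz_abs F a \<le> riesz_abs F (r *\<^sub>R a)" if "0 \<le> a" "0 < r" for a r
  proof -
    have "riesz_abs F a \<le> riesz_abs F (r *\<^sub>R a) / r"
    proof (rule least)
      fix y assume "\<bar>y\<bar> \<le> a"
      then have "\<bar>r *\<^sub>R y\<bar> \<le> r *\<^sub>R a"
        using abs_scaleR_nonneg[of r y] scaleR_left_mono[of "\<bar>y\<bar>" a r] that by force
      then have "F (r *\<^sub>R y) \<le> riesz_abs F (r *\<^sub>R a)" by (rule upper)
      then show "F y \<le> riesz_abs F (r *\<^sub>R a) / r" using that by (simp add: scaleR field_simps)
    qed (use that in simp)
    then show ?thesis using that by (simp add: field_simps)
  qed
  show "riesz_abs F (r *\<^sub>R a) = r * riesz_abs F a" if "0 \<le> a" "0 \<le> r" for a r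
  proof (cases "r = 0")
    case True
    have "riesz_abs F 0 \<le> 0" using that by (intro least) (auto simp: zero)
    moreover have "0 \<le> riesz_abs F 0" using upper[of 0 0] by (simp add: zero)
    ultimately show ?thesis using True by simp
  next
    case False
    have "(1 / r) * riesz_abs F (r *\<^sub>R a) \<le> riesz_abs F ((1 / r) *\<^sub>R (r *\<^sub>R a))"
      using that False by (intro le scaleR_nonneg_nonneg) auto
    then have "riesz_abs F (r *\<^sub>R a) \<le> r * riesz_abs F a"
      using that False by (simp add: field_simps)
    then show ?thesis using le[of a r] that False by simp
  qed
qed

lemma pprt_nprt_banach_lattice:
  fixes x :: "'a::banach_lattice"
  shows "x = pprt x - pprt (- x)" "norm (pprt x) \<le> norm x" "\<bar>x\<bar> = pprt x + pprt (- x)"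
proof -
  show "x = pprt x - pprt (- x)" using prts[of x] by (simp add: pprt_neg)
  show "\<bar>x\<bar> = pprt x + pprt (- x)" using abs_prts[of x] by (simp add: pprt_neg)
  have "pprt x \<le> \<bar>x\<bar>" by (simp add: pprt_def abs_ge_self)
  then show "norm (pprt x) \<le> norm x"
    using norm_mono_nonneg[OF zero_le_pprt] by fastforce
qed

lemma riesz_abs_extension:
  fixes F :: "'a::banach_lattice \<Rightarrow> real"
  assumes F: "bounded_linear F" and K: "\<And>x. \<bar>F x\<bar> \<le> K * norm x"
  obtains H where "bounded_linear H" "\<And>x. 0 \<le> x \<Longrightarrow> H x = riesz_abs F x"
    "\<And>x. \<bar>H x\<bar> \<le> K * norm x"
proof -
  note R = riesz_abs_props[OF F K]
  define H where "H x = riesz_abs F (pprt x) - riesz_abs F (pprt (- x))" for x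
  have H_diff: "H (a - b) = riesz_abs F a - riesz_abs F b" if "0 \<le> a" "0 \<le> b" for a b
  proof -
    have "pprt (a - b) + b = a + pprt (- (a - b))"
      using pprt_nprt_banach_lattice(1)[of "a - b"] by (simp add: algebra_simps)
    then have "riesz_abs F (pprt (a - b)) + riesz_abs F b = riesz_abs F a + riesz_abs F (pprt (- (a - b)))"
      using R(5) that zero_le_pprt by metis
    then show ?thesis by (simp add: H_def)
  qed
  have H_pos: "H x = riesz_abs F x" if "0 \<le> x" for x
    using H_diff[of x 0] R(6)[of 0 0] that by simp
  have H_add: "H (x + y) = H x + H y" for x y
  proof -
    have "x + y = (pprt x + pprt y) - (pprt (- x) + pprt (- y))"
      by (metis add_diff_add pprt_nprt_banach_lattice(1))
    then have "H (x + y) = riesz_abs F (pprt x + pprt y) - riesz_abs F (pprt (- x) + pprt (- y))"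
      using H_diff by simp
    then show ?thesis by (simp add: R(5) H_def)
  qed
  have H_minus: "H (- x) = - H x" for x by (simp add: H_def)
  have H_scale_pos: "H (r *\<^sub>R x) = r * H x" if "0 \<le> r" for r x
  proof -
    have "r *\<^sub>R x = r *\<^sub>R pprt x - r *\<^sub>R pprt (- x)"
      using pprt_nprt_banach_lattice(1)[of x] by (metis scaleR_diff_right)
    then have "H (r *\<^sub>R x) = riesz_abs F (r *\<^sub>R pprt x) - riesz_abs F (r *\<^sub>R pprt (- x))"
      using H_diff that by (simp add: scaleR_nonneg_nonneg)
    then show ?thesis using that by (simp add: R(6) H_def algebra_simps)
  qed
  have H_scale: "H (r *\<^sub>R x) = r *\<^sub>R H x" for r x
  proof (cases "0 \<le> r")
    case False
    then have "H (r *\<^sub>R x) = H (- ((- r) *\<^sub>R x))" by simp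
    also have "\<dots> = r * H x" using False H_minus H_scale_pos by (metis (no_types) linear minus_mult_minus minus_mult_left minus_minus neg_le_0_iff_le neg_0_le_iff_le)
    finally show ?thesis by simp
  qed (simp add: H_scale_pos)
  have H_bound: "\<bar>H x\<bar> \<le> K * norm x" for x
  proof -
    have "\<bar>H x\<bar> \<le> riesz_abs F (pprt x) + riesz_abs F (pprt (- x))"
      using R(4)[of "pprt x"] R(4)[of "pprt (- x)"] by (simp add: H_def)
    also have "\<dots> = riesz_abs F \<bar>x\<bar>" by (simp add: R(5) pprt_nprt_banach_lattice(3))
    also have "\<dots> \<le> K * norm x" using R(3)[of "\<bar>x\<bar>"] by simp
    finally show ?thesis .
  qed
  have "bounded_linear H"
    by (rule bounded_linear_intro[of _ K]) (use H_add H_scale H_bound in \<open>auto simp: mult.commute\<close>)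
  then show ?thesis using that H_pos H_bound by blast
qed


subsection \<open>Order and lattice structure\<close>

instantiation blinfun :: (banach_lattice, "{banach_lattice,linorder}") banach_lattice
begin

definition less_eq_blinfun :: "'a \<Rightarrow>\<^sub>L 'b \<Rightarrow> 'a \<Rightarrow>\<^sub>L 'b \<Rightarrow> bool" where
  "f \<le> g \<longleftrightarrow> (\<forall>x\<ge>0. blinfun_apply f x \<le> blinfun_apply g x)"

definition less_blinfun :: "'a \<Rightarrow>\<^sub>L 'b \<Rightarrow> 'a \<Rightarrow>\<^sub>L 'b \<Rightarrow> bool" where
  "f < g \<longleftrightarrow> f \<le> g \<and> \<not> g \<le> (f :: 'a \<Rightarrow>\<^sub>L 'b)"

text \<open>
  Suprema and infima are the order-theoretic ones; that they exist is part of the instance proof.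
\<close>

definition sup_blinfun :: "'a \<Rightarrow>\<^sub>L 'b \<Rightarrow> 'a \<Rightarrow>\<^sub>L 'b \<Rightarrow> 'a \<Rightarrow>\<^sub>L 'b" where
  "sup f g = (THE h :: 'a \<Rightarrow>\<^sub>L 'b. f \<le> h \<and> g \<le> h \<and> (\<forall>k. f \<le> k \<longrightarrow> g \<le> k \<longrightarrow> h \<le> k))"

definition inf_blinfun :: "'a \<Rightarrow>\<^sub>L 'b \<Rightarrow> 'a \<Rightarrow>\<^sub>L 'b \<Rightarrow> 'a \<Rightarrow>\<^sub>L 'b" where
  "inf f g = (THE h :: 'a \<Rightarrow>\<^sub>L 'b. h \<le> f \<and> h \<le> g \<and> (\<forall>k. k \<le> f \<longrightarrow> k \<le> g \<longrightarrow> k \<le> h))"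

definition abs_blinfun :: "'a \<Rightarrow>\<^sub>L 'b \<Rightarrow> 'a \<Rightarrow>\<^sub>L 'b" where
  "\<bar>f\<bar> = sup f (- f :: 'a \<Rightarrow>\<^sub>L 'b)"

instance
proof -
  note le = less_eq_blinfun_def
  have refl: "f \<le> f" for f :: "'a \<Rightarrow>\<^sub>L 'b" by (simp add: le)
  have trans: "f \<le> h" if "f \<le> g" "g \<le> h" for f g h :: "'a \<Rightarrow>\<^sub>L 'b"
    using that unfolding le by (meson order_trans)
  have asym: "f = g" if "f \<le> g" "g \<le> f" for f g :: "'a \<Rightarrow>\<^sub>L 'b"
  proof (rule blinfun_eqI)
    fix x :: 'a
    have eq: "blinfun_apply f z = blinfun_apply g z" if "0 \<le> z" for z
      using that \<open>f \<le> g\<close> \<open>g \<le> f\<close> by (simp add: le order_antisym)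
    show "blinfun_apply f x = blinfun_apply g x"
      using eq[of "pprt x"] eq[of "pprt (- x)"] pprt_nprt_banach_lattice(1)[of x]
      by (metis blinfun.diff_right zero_le_pprt)
  qed
  have add_mono: "h + f \<le> h + g" if "f \<le> g" for f g h :: "'a \<Rightarrow>\<^sub>L 'b"
    using that by (simp add: le blinfun.add_left)
  have scale_mono: "r *\<^sub>R f \<le> r *\<^sub>R g" if "f \<le> g" "0 \<le> r" for f g :: "'a \<Rightarrow>\<^sub>L 'b" and r :: real
    using that by (simp add: le blinfun.scaleR_left scaleR_left_mono)
  have neg_mono: "- g \<le> - f" if "f \<le> g" for f g :: "'a \<Rightarrow>\<^sub>L 'b"
    using that by (simp add: le blinfun.minus_left)

  have modulus: "\<exists>h. f \<le> h \<and> - f \<le> h \<and> (\<forall>k. f \<le> k \<longrightarrow> - f \<le> k \<longrightarrow> h \<le> k)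
      \<and> (\<forall>x. norm (blinfun_apply h x) \<le> norm f * norm x)" for f :: "'a \<Rightarrow>\<^sub>L 'b"
  proof -
    obtain u :: 'b where u: "0 \<le> u" "norm u \<le> 1" "\<And>y. y = signed_norm y *\<^sub>R u"
      by (metis signed_norm_repr)
    define F where "F x = signed_norm (blinfun_apply f x)" for x
    have K: "\<bar>F x\<bar> \<le> norm f * norm x" for x
      by (simp add: F_def abs_signed_norm norm_blinfun)
    have F: "bounded_linear F"
    proof (rule bounded_linear_intro[of _ "norm f"])
      show "norm (F x) \<le> norm x * norm f" for x using K[of x] by (simp add: mult.commute)
    qed (simp_all add: F_def blinfun.add_right blinfun.scaleR_right signed_norm_add signed_norm_scaleR)
    obtain H where H: "bounded_linear H" "\<And>x. 0 \<le> x \<Longrightarrow> H x = riesz_abs F x"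
      "\<And>x. \<bar>H x\<bar> \<le> norm f * norm x"
      using riesz_abs_extension[OF F K] by blast
    note R = riesz_abs_props[OF F K]
    define h where "h = Blinfun (\<lambda>x. H x *\<^sub>R u)"
    have h: "blinfun_apply h x = H x *\<^sub>R u" for x
      unfolding h_def using bounded_linear_scaleR_const[OF H(1), of u]
      by (simp add: bounded_linear_Blinfun_apply)
    have f: "blinfun_apply f x = F x *\<^sub>R u" for x unfolding F_def by (rule u(3))
    have "f \<le> h" unfolding le
    proof (intro allI impI)
      fix x :: 'a assume x: "0 \<le> x"
      then have "F x \<le> H x" using R(1)[of x x] H(2) by simp
      then show "blinfun_apply f x \<le> blinfun_apply h x"
        unfolding f h using u(1) by (rule scaleR_right_mono)
    qed
    moreover have "- f \<le> h" unfolding le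
    proof (intro allI impI)
      fix x :: 'a assume x: "0 \<le> x"
      have "- F x = F (- x)" using F by (metis bounded_linear.linear linear_neg)
      also have "\<dots> \<le> H x" using R(1)[of "- x" x] H(2) x by simp
      finally have "(- F x) *\<^sub>R u \<le> H x *\<^sub>R u" using u(1) by (rule scaleR_right_mono)
      then show "blinfun_apply (- f) x \<le> blinfun_apply h x"
        by (simp add: blinfun.minus_left f h)
    qed
    moreover have "h \<le> k" if k: "f \<le> k" "- f \<le> k" for k
      unfolding le
    proof (intro allI impI)
      fix x :: 'a assume x: "0 \<le> x"
      have kmono: "blinfun_apply k y \<le> blinfun_apply k x" if "0 \<le> y" "y \<le> x" for y
      proof -
        have z: "0 \<le> x - y" using that by simp
        have "0 \<le> blinfun_apply k (x - y)"
        proof -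
          have "blinfun_apply f (x - y) \<le> blinfun_apply k (x - y)"
               "- blinfun_apply f (x - y) \<le> blinfun_apply k (x - y)"
            using k z by (auto simp: le blinfun.minus_left)
          then have "\<bar>blinfun_apply f (x - y)\<bar> \<le> blinfun_apply k (x - y)" by (rule abs_leI)
          then show ?thesis using abs_ge_zero order_trans by blast
        qed
        then show ?thesis by (simp add: blinfun.diff_right)
      qed
      have "H x \<le> signed_norm (blinfun_apply k x)"
        unfolding H(2)[OF x]
      proof (rule R(2)[OF x])
        fix y :: 'a assume y: "\<bar>y\<bar> \<le> x"
        have "blinfun_apply f (pprt y) \<le> blinfun_apply k (pprt y)"
          using k by (simp add: le)
        moreover have "- blinfun_apply f (pprt (- y)) \<le> blinfun_apply k (pprt (- y))"
          using k by (simp add: le blinfun.minus_left)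
        ultimately have "blinfun_apply f (pprt y) - blinfun_apply f (pprt (- y))
            \<le> blinfun_apply k (pprt y) + blinfun_apply k (pprt (- y))"
          using add_mono_thms_linordered_semiring(1) by fastforce
        then have "blinfun_apply f y \<le> blinfun_apply k \<bar>y\<bar>"
          unfolding pprt_nprt_banach_lattice(3)[of y]
          by (metis blinfun.diff_right blinfun.add_right pprt_nprt_banach_lattice(1))
        also have "\<dots> \<le> blinfun_apply k x" using y by (intro kmono) simp
        finally show "F y \<le> signed_norm (blinfun_apply k x)"
          by (simp add: F_def signed_norm_le_iff)
      qed
      then have "H x *\<^sub>R u \<le> signed_norm (blinfun_apply k x) *\<^sub>R u"
        using u(1) by (rule scaleR_right_mono)
      then show "blinfun_apply h x \<le> blinfun_apply k x" unfolding h by (simp flip: u(3))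
    qed
    moreover have "norm (blinfun_apply h x) \<le> norm f * norm x" for x
    proof -
      have "norm (blinfun_apply h x) = \<bar>H x\<bar> * norm u" by (simp add: h)
      also have "\<dots> \<le> \<bar>H x\<bar>" using u(2) by (simp add: mult_left_le)
      finally show ?thesis using H(3)[of x] by linarith
    qed
    ultimately show ?thesis by blast
  qed

  have lub_ex: "\<exists>h. f \<le> h \<and> g \<le> h \<and> (\<forall>k. f \<le> k \<longrightarrow> g \<le> k \<longrightarrow> h \<le> k)" for f g :: "'a \<Rightarrow>\<^sub>L 'b"
  proof -
    obtain m where m: "f - g \<le> m" "- (f - g) \<le> m" "\<And>k. f - g \<le> k \<Longrightarrow> - (f - g) \<le> k \<Longrightarrow> m \<le> k"
      using modulus[of "f - g"] by blast
    define h where "h = (1/2) *\<^sub>R (f + g + m)"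
    have half: "(1/2) *\<^sub>R (a + a) = a" for a :: "'a \<Rightarrow>\<^sub>L 'b"
      by (simp flip: scaleR_2)
    have "f \<le> h"
    proof -
      have "(f + g) + (f - g) \<le> (f + g) + m" using m(1) by (rule add_mono)
      then have "(1/2) *\<^sub>R (f + f) \<le> h" unfolding h_def by (intro scale_mono) (simp_all add: algebra_simps)
      then show ?thesis unfolding half .
    qed
    moreover have "g \<le> h"
    proof -
      have "(f + g) + - (f - g) \<le> (f + g) + m" using m(2) by (rule add_mono)
      then have "(1/2) *\<^sub>R (g + g) \<le> h" unfolding h_def by (intro scale_mono) (simp_all add: algebra_simps)
      then show ?thesis unfolding half .
    qed
    moreover have "h \<le> k" if k: "f \<le> k" "g \<le> k" for k
    proof -
      have "f - g \<le> k + k - (f + g)"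
        using add_mono[OF add_mono[OF k(1), of "k - (f + g)"], of 0] scale_mono[OF k(1), of 2]
          add_mono[OF scale_mono[OF k(1), of 2], of "- f - g"]
        by (simp add: algebra_simps scaleR_2)
      moreover have "- (f - g) \<le> k + k - (f + g)"
        using add_mono[OF scale_mono[OF k(2), of 2], of "- f - g"]
        by (simp add: algebra_simps scaleR_2)
      ultimately have "m \<le> k + k - (f + g)" by (rule m(3))
      then have "(f + g) + m \<le> (f + g) + (k + k - (f + g))" by (rule add_mono)
      then have "h \<le> (1/2) *\<^sub>R (k + k)" unfolding h_def by (intro scale_mono) (simp_all add: algebra_simps)
      then show ?thesis unfolding half .
    qed
    ultimately show ?thesis by blast
  qed
  have sup: "f \<le> sup f g \<and> g \<le> sup f g \<and> (\<forall>k. f \<le> k \<longrightarrow> g \<le> k \<longrightarrow> sup f g \<le> k)"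
    for f g :: "'a \<Rightarrow>\<^sub>L 'b"
    unfolding sup_blinfun_def
    by (rule theI') (use lub_ex[of f g] asym in blast)
  have glb_ex: "\<exists>h. h \<le> f \<and> h \<le> g \<and> (\<forall>k. k \<le> f \<longrightarrow> k \<le> g \<longrightarrow> k \<le> h)" for f g :: "'a \<Rightarrow>\<^sub>L 'b"
  proof -
    obtain h where "- f \<le> h" "- g \<le> h" "\<And>k. - f \<le> k \<Longrightarrow> - g \<le> k \<Longrightarrow> h \<le> k"
      using lub_ex[of "- f" "- g"] by blast
    then show ?thesis using neg_mono by (metis minus_minus)
  qed
  have inf: "inf f g \<le> f \<and> inf f g \<le> g \<and> (\<forall>k. k \<le> f \<longrightarrow> k \<le> g \<longrightarrow> k \<le> inf f g)"
    for f g :: "'a \<Rightarrow>\<^sub>L 'b"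
    unfolding inf_blinfun_def
    by (rule theI') (use glb_ex[of f g] asym in blast)
  have abs_norm: "norm (blinfun_apply \<bar>f\<bar> x) \<le> norm f * norm x" for f :: "'a \<Rightarrow>\<^sub>L 'b" and x
  proof -
    obtain h where h: "f \<le> h" "- f \<le> h" "\<And>k. f \<le> k \<Longrightarrow> - f \<le> k \<Longrightarrow> h \<le> k"
      "\<And>x. norm (blinfun_apply h x) \<le> norm f * norm x"
      using modulus[of f] by blast
    have "\<bar>f\<bar> = h" unfolding abs_blinfun_def using h sup[of f "- f"] by (blast intro: asym)
    then show ?thesis using h(4) by simp
  qed
  have apply_abs: "\<bar>blinfun_apply f x\<bar> \<le> blinfun_apply \<bar>f\<bar> \<bar>x\<bar>" for f :: "'a \<Rightarrow>\<^sub>L 'b" and x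
  proof -
    have pos: "\<bar>blinfun_apply f z\<bar> \<le> blinfun_apply \<bar>f\<bar> z" if "0 \<le> z" for z
      using sup[of f "- f"] that
      by (intro abs_leI) (auto simp: le abs_blinfun_def blinfun.minus_left)
    have "\<bar>blinfun_apply f x\<bar> = \<bar>blinfun_apply f (pprt x) - blinfun_apply f (pprt (- x))\<bar>"
      by (metis blinfun.diff_right pprt_nprt_banach_lattice(1))
    also have "\<dots> \<le> \<bar>blinfun_apply f (pprt x)\<bar> + \<bar>blinfun_apply f (pprt (- x))\<bar>"
      by (rule abs_triangle_ineq4)
    also have "\<dots> \<le> blinfun_apply \<bar>f\<bar> (pprt x) + blinfun_apply \<bar>f\<bar> (pprt (- x))"
      by (rule Groups.add_mono[OF pos pos]) simp_all
    also have "\<dots> = blinfun_apply \<bar>f\<bar> \<bar>x\<bar>"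
      by (simp add: pprt_nprt_banach_lattice(3) blinfun.add_right)
    finally show ?thesis .
  qed
  have norm_mono: "norm f \<le> norm g" if "\<bar>f\<bar> \<le> \<bar>g\<bar>" for f g :: "'a \<Rightarrow>\<^sub>L 'b"
  proof (rule norm_blinfun_bound)
    fix x :: 'a
    have "\<bar>blinfun_apply f x\<bar> \<le> blinfun_apply \<bar>f\<bar> \<bar>x\<bar>" by (rule apply_abs)
    also have "\<dots> \<le> blinfun_apply \<bar>g\<bar> \<bar>x\<bar>" using that by (simp add: le)
    finally have "norm \<bar>blinfun_apply f x\<bar> \<le> norm (blinfun_apply \<bar>g\<bar> \<bar>x\<bar>)"
      by (intro norm_mono_nonneg) auto
    then show "norm (blinfun_apply f x) \<le> norm g * norm x"
      using abs_norm[of g "\<bar>x\<bar>"] by simp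
  qed simp

  show "OFCLASS('a \<Rightarrow>\<^sub>L 'b, banach_lattice_class)"
  proof
    fix f g h :: "'a \<Rightarrow>\<^sub>L 'b" and r s :: real
    show "f < g \<longleftrightarrow> f \<le> g \<and> \<not> g \<le> f" by (rule less_blinfun_def)
    show "f \<le> f" by (rule refl)
    show "f \<le> g \<Longrightarrow> g \<le> h \<Longrightarrow> f \<le> h" by (rule trans)
    show "f \<le> g \<Longrightarrow> g \<le> f \<Longrightarrow> f = g" by (rule asym)
    show "f \<le> g \<Longrightarrow> h + f \<le> h + g" by (rule add_mono)
    show "f \<le> g \<Longrightarrow> 0 \<le> r \<Longrightarrow> r *\<^sub>R f \<le> r *\<^sub>R g" by (rule scale_mono)
    show "r \<le> s \<Longrightarrow> 0 \<le> f \<Longrightarrow> r *\<^sub>R f \<le> s *\<^sub>R f"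
      by (simp add: le blinfun.scaleR_left scaleR_right_mono)
    show "inf f g \<le> f" "inf f g \<le> g" using inf[of f g] by auto
    show "f \<le> g \<Longrightarrow> f \<le> h \<Longrightarrow> f \<le> inf g h" using inf[of g h] by auto
    show "f \<le> sup f g" "g \<le> sup f g" using sup[of f g] by auto
    show "g \<le> f \<Longrightarrow> h \<le> f \<Longrightarrow> sup g h \<le> f" using sup[of g h] by auto
    show "\<bar>f\<bar> = sup f (- f)" by (rule abs_blinfun_def)
    show "\<bar>f\<bar> \<le> \<bar>g\<bar> \<Longrightarrow> norm f \<le> norm g" by (rule norm_mono)
  qed
qed

end


section \<open>Absolute topologies and boundaries\<close>

definition seminorm_topology :: "('a::real_vector \<Rightarrow> real) set \<Rightarrow> 'a topology" where
  "seminorm_topology P = topology_generated_by {{y. p (y - x) < e} | p x e. p \<in> P \<and> 0 < e}"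

text \<open>
  \<open>abs_sigma A\<close> is the topology \<open>|\<sigma>|(E, A)\<close>; in particular \<open>abs_sigma UNIV\<close> is the absolute weak
  topology of \<open>E\<close>.  (For \<open>A = {}\<close> the generated topology has empty carrier, so that case is
  not meaningful.)
\<close>

definition abs_sigma :: "('a::banach_lattice \<Rightarrow>\<^sub>L real) set \<Rightarrow> 'a topology" where
  "abs_sigma A = seminorm_topology ((\<lambda>f x. blinfun_apply \<bar>f\<bar> \<bar>x\<bar>) ` A)"

definition abs_weak_star :: "(('a::banach_lattice \<Rightarrow>\<^sub>L real) \<Rightarrow>\<^sub>L real) topology" where
  "abs_weak_star = seminorm_topology (range (\<lambda>f \<phi>. blinfun_apply \<bar>\<phi>\<bar> \<bar>f\<bar>))"

definition seq_compactin :: "'a topology \<Rightarrow> 'a set \<Rightarrow> bool" where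
  "seq_compactin X K \<longleftrightarrow> K \<subseteq> topspace X \<and>
     (\<forall>s :: nat \<Rightarrow> 'a. range s \<subseteq> K \<longrightarrow>
       (\<exists>l\<in>K. \<exists>r :: nat \<Rightarrow> nat. strict_mono r \<and> limitin X (s \<circ> r) l sequentially))"

definition abs_boundary :: "('a::banach_lattice \<Rightarrow>\<^sub>L real) set \<Rightarrow> bool" where
  "abs_boundary B \<longleftrightarrow> B \<subseteq> cball 0 1 \<and>
     (\<forall>x. \<exists>f\<^sub>0\<in>B. blinfun_apply \<bar>f\<^sub>0\<bar> \<bar>x\<bar> = (SUP f\<in>cball 0 1. blinfun_apply \<bar>f\<bar> \<bar>x\<bar>))"

end

theory Submission
  imports Defs
begin

text \<open>
  Write \<open>p x\<close> for the supremum of \<open>|f|(|x|)\<close> over the dual unit ball.  This is a seminorm, and on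
  an absolutely boundary \<open>B\<close> the supremum is attained.

  Sequences.  Suppose \<open>s\<close> is bounded and \<open>|f|(|s n|)\<close> tends to 0 for all \<open>f\<close> in \<open>B\<close>.  The vectors
  \<open>|s n|\<close> are positive, and so is every element of their closed convex hull; hence each such element
  attains its \<open>p\<close>-value at some \<open>|f|\<close> with \<open>f\<close> in \<open>B\<close>.  This is the situation of Simons' inequality
  (\<open>simons_null_sequence\<close>), which yields convex combinations of the \<open>|s n|\<close> of arbitrarily small
  \<open>p\<close>-value.  Applied to subsequences, this rules out \<open>|g|(|s n|) \<ge> e > 0\<close> infinitely often for
  any \<open>g\<close> in the dual (\<open>abs_boundary_null_sequence\<close>), because the inequality would pass to convex
  combinations.  So bounded sequences have the same limits for \<open>B\<close> as for the whole dual, and the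
  first claim follows.

  Compactness.  The absolute weak topology is the initial topology of the map sending \<open>x\<close> to its
  profile, the family of all numbers \<open>|f|(|x - a|)\<close>.  The profiles of a bounded set lie in a product
  of compact intervals, so by Tychonoff it suffices that the profiles of \<open>K\<close> form a closed set
  (\<open>closed_profile_image\<close>).  This is an Eberlein theorem, proved by Whitley's construction: a point
  \<open>\<phi>\<close> of the closure behaves like the distances \<open>|f|(|\<xi> - a|)\<close> to an ideal point \<open>\<xi>\<close>; one picks a
  sequence in \<open>K\<close> that approximates \<open>\<phi>\<close> at more and more coordinates \<open>(f, a)\<close>, where \<open>a\<close> runs through
  convex combinations of the earlier members and \<open>f\<close> norms \<open>\<xi> - a\<close> up to a factor 2.  The limit \<open>l\<close> in \<open>K\<close> of a
  subsequence agrees with \<open>\<phi>\<close> at these coordinates, and the small convex combinations above, which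
  replace Mazur's theorem, provide \<open>a\<close> with \<open>p (l - a)\<close> small.  Then \<open>\<xi> - a\<close> is small too, so \<open>\<phi>\<close> is
  the profile of \<open>l\<close>.
\<close>

section \<open>The pairing of a modulus with a modulus\<close>

abbreviation abs_pair :: "('a::banach_lattice \<Rightarrow>\<^sub>L real) \<Rightarrow> 'a \<Rightarrow> real" where
  "abs_pair f x \<equiv> blinfun_apply \<bar>f\<bar> \<bar>x\<bar>"

lemma abs_dual_mono:
  fixes f :: "'a::banach_lattice \<Rightarrow>\<^sub>L real"
  assumes "x \<le> y"
  shows "blinfun_apply \<bar>f\<bar> x \<le> blinfun_apply \<bar>f\<bar> y"
proof -
  have "0 \<le> \<bar>f\<bar>" by simp
  then have "0 \<le> blinfun_apply \<bar>f\<bar> (y - x)"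
    using assms unfolding less_eq_blinfun_def by simp
  then show ?thesis by (simp add: blinfun.diff_right)
qed

lemma abs_pair_nonneg: "0 \<le> abs_pair f x"
  using abs_dual_mono[of 0 "\<bar>x\<bar>" f] by simp

lemma abs_pair_triangle: "abs_pair f (x + y) \<le> abs_pair f x + abs_pair f y"
  using abs_dual_mono[OF abs_triangle_ineq, of f x y] by (simp add: blinfun.add_right)

lemma abs_pair_minus_commute: "abs_pair f (x - y) = abs_pair f (y - x)"
  by (simp add: abs_minus_commute)

lemma abs_pair_le_norm: "abs_pair f x \<le> norm f * norm x"
  using norm_blinfun[of "\<bar>f\<bar>" "\<bar>x\<bar>"] by simp

lemma abs_pair_scaleR_le:
  assumes "0 \<le> r"
  shows "abs_pair f (r *\<^sub>R x) \<le> r * abs_pair f x"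
  using abs_dual_mono[OF abs_scaleR_nonneg[OF assms], of f x] by (simp add: blinfun.scaleR_right)

lemma abs_pair_scaleR_dual_le:
  assumes "0 \<le> r"
  shows "abs_pair (r *\<^sub>R f) x \<le> r * abs_pair f x"
  using abs_scaleR_nonneg[OF assms, of f] unfolding less_eq_blinfun_def
  by (simp add: blinfun.scaleR_left)

text \<open>
  The norm of the canonical image of \<open>x\<close> in the bidual, written with moduli so that the supremum is
  the one an absolutely boundary attains.
\<close>

definition dual_sup :: "'a::banach_lattice \<Rightarrow> real" where
  "dual_sup x = (SUP f\<in>cball 0 1. abs_pair f x)"

lemma abs_pair_le_norm_unit:
  assumes "f \<in> cball 0 1"
  shows "abs_pair f x \<le> norm x"
proof -
  have "norm f * norm x \<le> 1 * norm x" using assms by (intro mult_right_mono) auto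
  then show ?thesis using abs_pair_le_norm[of f x] by simp
qed

lemma abs_pair_le_dual_sup: "f \<in> cball 0 1 \<Longrightarrow> abs_pair f x \<le> dual_sup x"
  unfolding dual_sup_def by (intro cSUP_upper bdd_aboveI2[where M = "norm x"] abs_pair_le_norm_unit)

lemma dual_sup_least: "(\<And>f. f \<in> cball 0 1 \<Longrightarrow> abs_pair f x \<le> c) \<Longrightarrow> dual_sup x \<le> c"
  unfolding dual_sup_def by (rule cSUP_least) auto

lemma dual_sup_le_norm: "dual_sup x \<le> norm x"
  by (intro dual_sup_least abs_pair_le_norm_unit)

lemma dual_sup_triangle: "dual_sup (x + y) \<le> dual_sup x + dual_sup y"
  by (intro dual_sup_least order_trans[OF abs_pair_triangle] add_mono abs_pair_le_dual_sup)

lemma dual_sup_scaleR_le: "0 \<le> r \<Longrightarrow> dual_sup (r *\<^sub>R x) \<le> r * dual_sup x"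
  by (intro dual_sup_least order_trans[OF abs_pair_scaleR_le] mult_left_mono abs_pair_le_dual_sup)

lemma dual_sup_mono: "\<bar>x\<bar> \<le> \<bar>y\<bar> \<Longrightarrow> dual_sup x \<le> dual_sup y"
  by (rule dual_sup_least) (rule order_trans[OF abs_dual_mono abs_pair_le_dual_sup])

lemma abs_pair_normalize: "\<exists>g\<in>cball 0 1. \<forall>x. abs_pair f x \<le> norm f * abs_pair g x"
proof
  show "\<forall>x. abs_pair f x \<le> norm f * abs_pair (sgn f) x"
  proof
    fix x
    show "abs_pair f x \<le> norm f * abs_pair (sgn f) x"
      using abs_pair_scaleR_dual_le[of "norm f" "sgn f" x] by (cases "f = 0") (simp_all add: sgn_div_norm)
  qed
  show "sgn f \<in> cball 0 1" by (simp add: norm_sgn)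
qed

lemma abs_pair_le_norm_dual_sup: "abs_pair f x \<le> norm f * dual_sup x"
proof -
  obtain g where g: "g \<in> cball 0 1" "abs_pair f x \<le> norm f * abs_pair g x"
    using abs_pair_normalize by blast
  show ?thesis
    by (rule order_trans[OF g(2)]) (intro mult_left_mono abs_pair_le_dual_sup g(1) norm_ge_zero)
qed

section \<open>Simons' inequality for null sequences\<close>

text \<open>
  With \<open>C n\<close> the closed convex hull of the tail from \<open>n\<close> on, the proof picks \<open>z m\<close> in \<open>C m\<close> greedily
  such that \<open>u m + z m\<close> almost minimises \<open>p\<close> over \<open>u m + C m\<close>, where \<open>u m\<close> is \<open>2 ^ m\<close> times the partial
  sum of the series of \<open>z k / 2 ^ (k + 1)\<close>.  Let \<open>v\<close> be the sum of the series.  The rescaled remainder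
  \<open>2 ^ m v - u m\<close> belongs to \<open>C m\<close>, so it competes in the minimisation, and a telescoping argument
  bounds \<open>p (u m)\<close> by \<open>(2 ^ m - 1) p v\<close> up to a small error.  A functional \<open>f\<close> attaining \<open>p v\<close> at
  \<open>v\<close> therefore has almost the value \<open>p v \<ge> c\<close> at \<open>2 ^ m v - u m\<close>.  If \<open>c\<close> were positive, this would
  contradict that \<open>f\<close> becomes small on \<open>C m\<close> for large \<open>m\<close>.
\<close>

lemma simons_null_sequence:
  fixes p :: "'a::banach \<Rightarrow> real" and y :: "nat \<Rightarrow> 'a" and F :: "('a \<Rightarrow>\<^sub>L real) set"
  assumes p_add: "\<And>u v. p (u + v) \<le> p u + p v"
    and p_scale: "\<And>r u. 0 \<le> r \<Longrightarrow> p (r *\<^sub>R u) \<le> r * p u"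
    and p_norm: "\<And>u. p u \<le> norm u"
    and bdd: "bounded (range y)"
    and F_le: "\<And>f u. f \<in> F \<Longrightarrow> blinfun_apply f u \<le> p u"
    and attained: "\<And>v. v \<in> closure (convex hull range y) \<Longrightarrow> \<exists>f\<in>F. blinfun_apply f v = p v"
    and null: "\<And>f. f \<in> F \<Longrightarrow> (\<lambda>n. blinfun_apply f (y n)) \<longlonglongrightarrow> 0"
    and lower: "\<And>v. v \<in> convex hull range y \<Longrightarrow> c \<le> p v"
  shows "c \<le> 0"
proof (rule ccontr)
  assume "\<not> c \<le> 0"
  then have c: "0 < c" by simp
  define C where "C n = closure (convex hull (y ` {n..}))" for n
  have C_convex: "convex (C n)" and C_closed: "closed (C n)" for n
    by (simp_all add: C_def convex_closure convex_convex_hull)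
  have y_C: "y k \<in> C n" if "n \<le> k" for n k
    unfolding C_def by (rule closure_subset[THEN subsetD], rule hull_inc) (use that in auto)
  have C_antimono: "C n \<subseteq> C m" if "m \<le> n" for m n
    unfolding C_def by (intro closure_mono hull_mono image_mono) (use that in auto)
  have range_y: "y ` {0..} = range y" by auto
  have C0: "C 0 = closure (convex hull range y)"
    by (simp add: C_def range_y)
  have p_diff: "p u - p v \<le> norm (u - v)" for u v
    using p_add[of "u - v" v] p_norm[of "u - v"] by simp
  have p_cont: "continuous_on UNIV p"
  proof (rule continuous_onI)
    fix u e assume "0 < (e::real)"
    moreover have "dist (p u') (p u) \<le> dist u' u" for u'
      using p_diff[of u u'] p_diff[of u' u] by (simp add: dist_norm norm_minus_commute abs_le_iff)
    ultimately show "\<exists>d>0. \<forall>u'\<in>UNIV. dist u' u < d \<longrightarrow> dist (p u') (p u) \<le> e"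
      by (meson less_eq_real_def order_trans)
  qed
  have lower_C: "c \<le> p v" if "v \<in> C 0" for v
  proof -
    have "closed {v. c \<le> p v}"
      by (intro closed_Collect_le continuous_on_const p_cont)
    then have "C 0 \<subseteq> {v. c \<le> p v}"
      unfolding C0 by (intro closure_minimal) (use lower in auto)
    then show ?thesis using that by blast
  qed
  obtain M where M: "\<And>x. x \<in> C 0 \<Longrightarrow> norm x \<le> M"
    using bounded_closure[OF bounded_convex_hull[OF bdd]] C0 unfolding bounded_iff by metis
  \<comment> \<open>The tolerances of the greedy choice add up to \<open>c / 2\<close>.\<close>
  define d where "d m = c / 2 / 2 ^ Suc m" for m :: nat
  have d: "0 < d m" for m using c by (simp add: d_def)
  have "\<exists>z\<in>C m. \<forall>w\<in>C m. p (u + z) \<le> p (u + w) + d m" for m u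
  proof -
    let ?I = "INF w\<in>C m. p (u + w)"
    have ne: "C m \<noteq> {}" using y_C[of m m] by blast
    have "bdd_below ((\<lambda>w. p (u + w)) ` C m)"
    proof (rule bdd_belowI2)
      fix w assume "w \<in> C m"
      then have "w \<in> C 0" using C_antimono[of 0 m] by auto
      then have "norm w \<le> M" by (rule M)
      moreover have "p 0 - p (u + w) \<le> norm (u + w)"
        using p_diff[of 0 "u + w"] norm_minus_cancel[of "u + w"] by simp
      ultimately show "p 0 - norm u - M \<le> p (u + w)" using norm_triangle_ineq[of u w] by linarith
    qed
    moreover obtain z where "z \<in> C m" "p (u + z) < ?I + d m"
      using cInf_lessD[of "(\<lambda>w. p (u + w)) ` C m" "?I + d m"] ne d[of m] by auto
    ultimately show ?thesis by (metis (no_types, lifting) cINF_lower add_right_mono less_eq_real_def order_trans)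
  qed
  then obtain Z where Z: "\<And>m u. Z m u \<in> C m" "\<And>m u w. w \<in> C m \<Longrightarrow> p (u + Z m u) \<le> p (u + w) + d m"
    by metis
  define u where "u = rec_nat 0 (\<lambda>m u. 2 *\<^sub>R u + Z m u)"
  define z where "z m = Z m (u m)" for m
  have u0: "u 0 = 0" and uS: "u (Suc m) = 2 *\<^sub>R u m + z m" for m
    by (simp_all add: u_def z_def)
  have zC: "z m \<in> C m" for m by (simp add: z_def Z)
  have u_sum: "(1 / 2 ^ n) *\<^sub>R u n = (\<Sum>k<n. (1 / 2 ^ Suc k) *\<^sub>R z k)" for n
  proof (induction n)
    case (Suc n)
    have "(1 / 2 ^ Suc n) *\<^sub>R u (Suc n) = (1 / 2 ^ n) *\<^sub>R u n + (1 / 2 ^ Suc n) *\<^sub>R z n"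
      unfolding uS by (simp add: scaleR_add_right)
    with Suc show ?case by simp
  qed (simp add: u0)
  have "summable (\<lambda>k. (1 / 2 ^ Suc k) *\<^sub>R z k)"
  proof (rule summable_comparison_test')
    show "summable (\<lambda>k. M * (1/2) ^ Suc k)"
      by (intro summable_mult) (simp only: summable_Suc_iff, simp)
    fix k
    have "z k \<in> C 0" using zC[of k] C_antimono[of 0 k] by auto
    then show "norm ((1 / 2 ^ Suc k) *\<^sub>R z k) \<le> M * (1/2) ^ Suc k"
      using M[of "z k"] by (simp add: field_simps power_divide)
  qed
  then obtain v where v: "(\<lambda>n. (1 / 2 ^ n) *\<^sub>R u n) \<longlonglongrightarrow> v"
    unfolding u_sum summable_def sums_def by blast
  \<comment> \<open>The rescaled remainder, with the part of the series beyond \<open>m + j\<close> replaced by a multiple of a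
    single element \<open>x\<close> that keeps the total weight equal to 1.\<close>
  have hull_step: "(1 / 2 ^ j) *\<^sub>R (u (m + j) + x) - u m \<in> C m" if "x \<in> C m" for m j x
    using that
  proof (induction j arbitrary: x)
    case (Suc j)
    let ?x = "(1/2) *\<^sub>R z (m + j) + (1/2) *\<^sub>R x"
    have "z (m + j) \<in> C m" using zC C_antimono[of m "m + j"] by auto
    then have "?x \<in> C m" using Suc.prems by (intro convexD[OF C_convex]) auto
    moreover have "(1 / 2 ^ Suc j) *\<^sub>R (u (m + Suc j) + x) = (1 / 2 ^ j) *\<^sub>R (u (m + j) + ?x)"
      by (simp add: uS scaleR_add_right mult.commute)
    ultimately show ?case using Suc.IH by metis
  qed simp
  have tail: "2 ^ m *\<^sub>R v - u m \<in> C m" for m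
  proof (rule closed_sequentially[OF C_closed])
    show "(1 / 2 ^ j) *\<^sub>R (u (m + j) + z m) - u m \<in> C m" for j
      by (rule hull_step[OF zC])
    have "(\<lambda>j. (1 / 2 ^ (j + m)) *\<^sub>R u (j + m)) \<longlonglongrightarrow> v"
      by (rule LIMSEQ_ignore_initial_segment[OF v])
    then have "(\<lambda>j. 2 ^ m *\<^sub>R ((1 / 2 ^ (j + m)) *\<^sub>R u (j + m))) \<longlonglongrightarrow> 2 ^ m *\<^sub>R v"
      by (intro tendsto_scaleR tendsto_const)
    then have A: "(\<lambda>j. (1 / 2 ^ j) *\<^sub>R u (m + j)) \<longlonglongrightarrow> 2 ^ m *\<^sub>R v"
      by (simp add: power_add add.commute)
    have "(\<lambda>j. (1 / 2) ^ j *\<^sub>R z m) \<longlonglongrightarrow> 0 *\<^sub>R z m"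
      by (intro tendsto_scaleR tendsto_const LIMSEQ_realpow_zero) auto
    then have "(\<lambda>j. (1 / 2 ^ j) *\<^sub>R z m) \<longlonglongrightarrow> 0" by (simp add: power_divide)
    from tendsto_diff[OF tendsto_add[OF A this] tendsto_const[of "u m"]]
    show "(\<lambda>j. (1 / 2 ^ j) *\<^sub>R (u (m + j) + z m) - u m) \<longlonglongrightarrow> 2 ^ m *\<^sub>R v - u m"
      by (simp add: scaleR_add_right)
  qed
  have vC: "v \<in> C 0" using tail[of 0] by (simp add: u0)
  then obtain f where f: "f \<in> F" "blinfun_apply f v = p v" using attained C0 by blast
  \<comment> \<open>The remainder \<open>2 ^ m v - u m\<close> is the competitor to \<open>z m\<close>, and it turns \<open>u m\<close> into \<open>2 ^ m v\<close>.\<close>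
  have step: "p (u (Suc m)) \<le> p (u m) + 2 ^ m * p v + d m" for m
  proof -
    have "p (u (Suc m)) \<le> p (u m + z m) + p (u m)"
      using p_add[of "u m + z m" "u m"] by (simp add: uS scaleR_2 algebra_simps)
    also have "p (u m + z m) \<le> p (2 ^ m *\<^sub>R v) + d m"
      using Z(2)[OF tail[of m], of "u m"] by (simp add: z_def)
    also have "p (2 ^ m *\<^sub>R v) \<le> 2 ^ m * p v" by (rule p_scale) simp
    finally show ?thesis by simp
  qed
  have u_bound: "p (u m) \<le> (2 ^ m - 1) * p v + (c / 2 - c / 2 / 2 ^ m)" for m
  proof (induction m)
    case 0
    then show ?case using p_scale[of 0 0] by (simp add: u0)
  next
    case (Suc m)
    have e: "d m = c / 2 / 2 ^ m - c / 2 / 2 ^ Suc m" by (simp add: d_def field_simps)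
    have "p (u (Suc m)) \<le> (2 ^ m - 1) * p v + (c / 2 - c / 2 / 2 ^ m) + 2 ^ m * p v + d m"
      using Suc step[of m] by linarith
    also have "\<dots> = (2 ^ Suc m - 1) * p v + (c / 2 - c / 2 / 2 ^ Suc m)"
      unfolding e by (simp add: algebra_simps)
    finally show ?case .
  qed
  obtain m where m: "\<And>k. m \<le> k \<Longrightarrow> blinfun_apply f (y k) < c / 4"
    using order_tendstoD(2)[OF null[OF f(1)], of "c / 4"] c unfolding eventually_sequentially by auto
  have "C m \<subseteq> {x. blinfun_apply f x \<le> c / 4}"
    unfolding C_def
  proof (intro closure_minimal hull_minimal)
    show "convex {x. blinfun_apply f x \<le> c / 4}"
    proof (rule convexI)
      fix a b :: 'a and s t :: real
      assume *: "a \<in> {x. blinfun_apply f x \<le> c / 4}" "b \<in> {x. blinfun_apply f x \<le> c / 4}"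
        "0 \<le> s" "0 \<le> t" "s + t = 1"
      then have "s * blinfun_apply f a + t * blinfun_apply f b \<le> c / 4"
        by (intro convex_bound_le) auto
      then show "s *\<^sub>R a + t *\<^sub>R b \<in> {x. blinfun_apply f x \<le> c / 4}"
        by (simp add: blinfun.add_right blinfun.scaleR_right)
    qed
    show "closed {x. blinfun_apply f x \<le> c / 4}"
      by (intro closed_Collect_le continuous_intros)
  qed (use m in \<open>auto simp: less_imp_le\<close>)
  then have "blinfun_apply f (2 ^ m *\<^sub>R v - u m) \<le> c / 4" using tail by blast
  then have "2 ^ m * p v - blinfun_apply f (u m) \<le> c / 4"
    by (simp add: blinfun.diff_right blinfun.scaleR_right f)
  moreover have "blinfun_apply f (u m) \<le> p (u m)" by (rule F_le[OF f(1)])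
  moreover have "c \<le> p v" by (rule lower_C[OF vC])
  moreover have "0 < c / 2 / 2 ^ m" using c by simp
  moreover have "p (u m) \<le> 2 ^ m * p v - p v + (c / 2 - c / 2 / 2 ^ m)"
    using u_bound[of m] by (simp add: left_diff_distrib)
  ultimately show False using c by linarith
qed


section \<open>Convergence on a boundary implies convergence everywhere\<close>

lemma continuous_on_abs_banach_lattice: "continuous_on S (abs :: 'a \<Rightarrow> 'a::banach_lattice)"
proof (rule continuous_onI)
  fix x e assume "0 < (e::real)"
  have "dist \<bar>x'\<bar> \<bar>x\<bar> \<le> dist x' x" for x' :: 'a
    unfolding dist_norm by (intro norm_mono_abs abs_triangle_ineq3)
  then show "\<exists>d>0. \<forall>x'\<in>S. dist x' x < d \<longrightarrow> dist \<bar>x'\<bar> \<bar>x\<bar> \<le> e"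
    using \<open>0 < e\<close> by (meson less_eq_real_def order_trans)
qed

lemma closure_convex_hull_nonneg:
  fixes S :: "'a::banach_lattice set"
  assumes "\<And>x. x \<in> S \<Longrightarrow> 0 \<le> x" and v: "v \<in> closure (convex hull S)"
  shows "0 \<le> v"
proof -
  have "0 \<le> x \<longleftrightarrow> \<bar>x\<bar> = x" for x :: 'a by (metis abs_of_nonneg abs_ge_zero)
  then have eq: "{x::'a. 0 \<le> x} = {x. \<bar>x\<bar> = x}" by blast
  have "closed {x::'a. 0 \<le> x}"
    unfolding eq by (intro closed_Collect_eq continuous_on_abs_banach_lattice continuous_on_id)
  moreover have "convex {x::'a. 0 \<le> x}"
    by (auto intro!: convexI add_nonneg_nonneg scaleR_nonneg_nonneg)
  ultimately have "closure (convex hull S) \<subseteq> {x. 0 \<le> x}"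
    using assms(1) by (intro closure_minimal hull_minimal) auto
  then show ?thesis using v by blast
qed

lemma abs_boundary_attains:
  assumes "abs_boundary B"
  obtains f where "f \<in> B" "abs_pair f x = dual_sup x"
  using assms unfolding abs_boundary_def dual_sup_def by blast

text \<open>
  Positivity enters here: a boundary controls \<open>|f|(|x|)\<close>, not the value of a functional at \<open>x\<close>, but
  on the closed convex hull of the positive vectors \<open>|s n|\<close> the two agree for the functional \<open>|f|\<close>.
  The lemma also takes the place of Mazur's theorem in the compactness proof.
\<close>

lemma abs_boundary_small_convex_combination:
  fixes s :: "nat \<Rightarrow> 'a::banach_lattice"
  assumes B: "abs_boundary B" and bdd: "bounded (range s)"
    and null: "\<And>f. f \<in> B \<Longrightarrow> (\<lambda>n. abs_pair f (s n)) \<longlonglongrightarrow> 0" and "0 < e"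
  obtains v where "v \<in> convex hull (range (\<lambda>n. \<bar>s n\<bar>))" "dual_sup v < e"
proof -
  have "e \<le> 0" if *: "\<And>v. v \<in> convex hull (range (\<lambda>n. \<bar>s n\<bar>)) \<Longrightarrow> e \<le> dual_sup v"
  proof (rule simons_null_sequence[where p = dual_sup and y = "\<lambda>n. \<bar>s n\<bar>" and F = "abs ` B"])
    show "bounded (range (\<lambda>n. \<bar>s n\<bar>))" using bdd by (simp add: bounded_iff)
    show "blinfun_apply g u \<le> dual_sup u" if g: "g \<in> abs ` B" for g u
    proof -
      obtain f where f: "f \<in> B" "g = \<bar>f\<bar>" using g by blast
      have "blinfun_apply \<bar>f\<bar> u \<le> abs_pair f u" by (intro abs_dual_mono abs_ge_self)
      also have "\<dots> \<le> dual_sup u"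
        using B f by (intro abs_pair_le_dual_sup) (auto simp: abs_boundary_def)
      finally show ?thesis using f by simp
    qed
    show "\<exists>g\<in>abs ` B. blinfun_apply g v = dual_sup v"
      if "v \<in> closure (convex hull range (\<lambda>n. \<bar>s n\<bar>))" for v
    proof -
      have "0 \<le> v" by (rule closure_convex_hull_nonneg[OF _ that]) auto
      then show ?thesis using abs_boundary_attains[OF B, of v] by (metis abs_of_nonneg imageI)
    qed
  qed (use null * in \<open>auto intro: dual_sup_triangle dual_sup_scaleR_le dual_sup_le_norm\<close>)
  then show ?thesis using that \<open>0 < e\<close> by (meson not_le)
qed

text \<open>
  If \<open>|g|\<close> stayed above \<open>e > 0\<close> along a subsequence of \<open>|s n|\<close>, it would do so on all convex
  combinations of that subsequence, although some of these are arbitrarily small.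
\<close>

lemma abs_boundary_null_sequence:
  fixes s :: "nat \<Rightarrow> 'a::banach_lattice"
  assumes B: "abs_boundary B" and bdd: "bounded (range s)"
    and null: "\<And>f. f \<in> B \<Longrightarrow> (\<lambda>n. abs_pair f (s n)) \<longlonglongrightarrow> 0"
  shows "(\<lambda>n. abs_pair g (s n)) \<longlonglongrightarrow> 0"
proof (rule ccontr)
  assume "\<not> ?thesis"
  then obtain e where e: "0 < e" "\<exists>\<^sub>F n in sequentially. e \<le> abs_pair g (s n)"
    by (auto simp: tendsto_iff frequently_def abs_pair_nonneg not_le)
  have "infinite {n. e \<le> abs_pair g (s n)}"
    using e(2)
    by (simp only: cofinite_eq_sequentially[symmetric] frequently_cofinite not_not simp_thms)
  then obtain r :: "nat \<Rightarrow> nat" where r: "strict_mono r" "\<And>n. e \<le> abs_pair g (s (r n))"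
    using infinite_enumerate[of "{n. e \<le> abs_pair g (s n)}"] by auto
  have lower: "e \<le> norm g * dual_sup v" if "v \<in> convex hull (range (\<lambda>n. \<bar>s (r n)\<bar>))" for v
  proof -
    have "convex {v. e \<le> blinfun_apply \<bar>g\<bar> v}"
    proof (rule convexI)
      fix a b :: 'a and p q :: real
      assume *: "a \<in> {v. e \<le> blinfun_apply \<bar>g\<bar> v}" "b \<in> {v. e \<le> blinfun_apply \<bar>g\<bar> v}"
        "0 \<le> p" "0 \<le> q" "p + q = 1"
      then have "- (p * blinfun_apply \<bar>g\<bar> a + q * blinfun_apply \<bar>g\<bar> b) \<le> - e"
        using convex_bound_le[of "- blinfun_apply \<bar>g\<bar> a" "- e" "- blinfun_apply \<bar>g\<bar> b" p q] by simp
      then show "p *\<^sub>R a + q *\<^sub>R b \<in> {v. e \<le> blinfun_apply \<bar>g\<bar> v}"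
        by (simp add: blinfun.add_right blinfun.scaleR_right)
    qed
    then have "convex hull (range (\<lambda>n. \<bar>s (r n)\<bar>)) \<subseteq> {v. e \<le> blinfun_apply \<bar>g\<bar> v}"
      using r by (intro hull_minimal) auto
    then have "e \<le> blinfun_apply \<bar>g\<bar> v" using that by blast
    also have "\<dots> \<le> abs_pair g v" by (intro abs_dual_mono abs_ge_self)
    also have "\<dots> \<le> norm g * dual_sup v" by (rule abs_pair_le_norm_dual_sup)
    finally show ?thesis .
  qed
  have g: "0 < norm g" using r(2)[of 0] e(1) abs_pair_le_norm[of g "s (r 0)"] by auto
  have "bounded (range (\<lambda>n. s (r n)))" by (rule bounded_subset[OF bdd]) auto
  moreover have "(\<lambda>n. abs_pair f (s (r n))) \<longlonglongrightarrow> 0" if "f \<in> B" for f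
    using LIMSEQ_subseq_LIMSEQ[OF null[OF that] r(1)] by (simp add: o_def)
  ultimately obtain v where "v \<in> convex hull (range (\<lambda>n. \<bar>s (r n)\<bar>))" "dual_sup v < e / norm g"
    using abs_boundary_small_convex_combination[OF B] e(1) g by (metis divide_pos_pos)
  then show False using lower[of v] g by (simp add: field_simps)
qed

section \<open>Limits in the absolute topologies\<close>

lemma topspace_abs_sigma:
  assumes "A \<noteq> {}"
  shows "topspace (abs_sigma A) = UNIV"
proof -
  obtain f where "f \<in> A" using assms by blast
  have "x \<in> topspace (abs_sigma A)" for x
  proof -
    have "x \<in> {y. abs_pair f (y - x) < 1}" by simp
    moreover have "{y. abs_pair f (y - x) < 1} \<in>
        {{y. p (y - x) < e} | p x e. p \<in> (\<lambda>f. abs_pair f) ` A \<and> 0 < e}"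
      using \<open>f \<in> A\<close> by (auto intro!: exI[of _ "abs_pair f"] exI[of _ x] exI[of _ 1])
    ultimately show ?thesis
      unfolding abs_sigma_def seminorm_topology_def topology_generated_by_topspace by blast
  qed
  then show ?thesis by blast
qed

lemma openin_abs_sigma_ball:
  assumes "f \<in> A" "0 < e"
  shows "openin (abs_sigma A) {y. abs_pair f (y - x) < e}"
  unfolding abs_sigma_def seminorm_topology_def
  by (rule topology_generated_by_Basis)
    (use assms in \<open>auto intro!: exI[of _ "abs_pair f"] exI[of _ x] exI[of _ e]\<close>)

text \<open>
  The generating sets are balls around arbitrary centres \<open>x\<close>; the triangle inequality puts a smaller
  ball around \<open>l\<close> inside each of them that contains \<open>l\<close>.
\<close>

lemma limitin_abs_sigma:
  assumes "A \<noteq> {}"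
  shows "limitin (abs_sigma A) s l sequentially \<longleftrightarrow> (\<forall>f\<in>A. (\<lambda>n. abs_pair f (s n - l)) \<longlonglongrightarrow> 0)"
proof
  assume lim: "limitin (abs_sigma A) s l sequentially"
  show "\<forall>f\<in>A. (\<lambda>n. abs_pair f (s n - l)) \<longlonglongrightarrow> 0"
  proof
    fix f assume f: "f \<in> A"
    show "(\<lambda>n. abs_pair f (s n - l)) \<longlonglongrightarrow> 0"
    proof (rule tendstoI)
      fix e :: real assume "0 < e"
      have "l \<in> {y. abs_pair f (y - l) < e}" using \<open>0 < e\<close> by simp
      with lim openin_abs_sigma_ball[OF f \<open>0 < e\<close>]
      have "\<forall>\<^sub>F n in sequentially. s n \<in> {y. abs_pair f (y - l) < e}"
        unfolding limitin_def by blast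
      then show "\<forall>\<^sub>F n in sequentially. dist (abs_pair f (s n - l)) 0 < e"
        by (simp add: abs_pair_nonneg)
    qed
  qed
next
  assume null: "\<forall>f\<in>A. (\<lambda>n. abs_pair f (s n - l)) \<longlonglongrightarrow> 0"
  have "\<forall>\<^sub>F n in sequentially. s n \<in> U" if "openin (abs_sigma A) U" "l \<in> U" for U
  proof -
    have "generate_topology_on {{y. p (y - x) < e} | p x e. p \<in> (\<lambda>f. abs_pair f) ` A \<and> 0 < e} U"
      using that(1) unfolding abs_sigma_def seminorm_topology_def openin_topology_generated_by_iff .
    then show ?thesis using \<open>l \<in> U\<close>
    proof (induction rule: generate_topology_on.induct)
      case (Int a b)
      then show ?case by (simp add: eventually_conj)
    next
      case (UN k)
      from UN.prems obtain U where U: "U \<in> k" "l \<in> U" by (rule UnionE)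
      show ?case by (rule eventually_mono[OF UN.IH[OF U]]) (rule UnionI[OF U(1)])
    next
      case (Basis U)
      then obtain f x e where U: "f \<in> A" "U = {y. abs_pair f (y - x) < e}" by blast
      have "(\<lambda>n. abs_pair f (s n - l)) \<longlonglongrightarrow> 0" using null U(1) by (rule bspec)
      moreover have "0 < e - abs_pair f (l - x)" using Basis.prems U(2) by simp
      ultimately have "\<forall>\<^sub>F n in sequentially. abs_pair f (s n - l) < e - abs_pair f (l - x)"
        by (rule order_tendstoD(2))
      then show ?case
      proof (rule eventually_mono)
        fix n assume "abs_pair f (s n - l) < e - abs_pair f (l - x)"
        then show "s n \<in> U" using abs_pair_triangle[of f "s n - l" "l - x"] U by simp
      qed
    qed simp
  qed
  then show "limitin (abs_sigma A) s l sequentially"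
    by (simp add: limitin_def topspace_abs_sigma[OF assms])
qed

section \<open>Compactness\<close>

text \<open>
  Recording the distances to all points \<open>a\<close>, and not just to 0, makes the absolute weak topology the
  initial topology of this map into a product of real lines, even though the map is not linear.
\<close>

definition profile :: "'a::banach_lattice \<Rightarrow> ('a \<Rightarrow>\<^sub>L real) \<times> 'a \<Rightarrow> real" where
  "profile x = (\<lambda>(f, a). abs_pair f (x - a))"

lemma openin_abs_sigma_profile:
  assumes "openin (abs_sigma UNIV) U"
  shows "\<exists>V. open V \<and> U = profile -` V"
proof -
  have "generate_topology_on {{y. p (y - x) < e} | p x e. p \<in> range (\<lambda>f. abs_pair f) \<and> 0 < e} U"
    using assms unfolding abs_sigma_def seminorm_topology_def openin_topology_generated_by_iff .
  then show ?thesis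
  proof (induction rule: generate_topology_on.induct)
    case Empty
    show ?case by (intro exI[of _ "{}"]) simp
  next
    case (Int a b)
    then obtain V W where "open V" "a = profile -` V" "open W" "b = profile -` W" by blast
    then show ?case by (intro exI[of _ "V \<inter> W"]) auto
  next
    case (UN k)
    then obtain V where V: "\<And>u. u \<in> k \<Longrightarrow> open (V u) \<and> u = profile -` V u" by metis
    then have "\<Union>k = profile -` (\<Union>u\<in>k. V u)" by blast
    then show ?case using V by (intro exI[of _ "\<Union>u\<in>k. V u"]) auto
  next
    case (Basis U)
    then obtain f x e where U: "U = {y. abs_pair f (y - x) < e}" by blast
    have "open {\<phi> :: ('a \<Rightarrow>\<^sub>L real) \<times> 'a \<Rightarrow> real. \<phi> (f, x) < e}"
      by (intro open_Collect_less continuous_on_product_coordinates continuous_on_const)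
    then show ?case by (intro exI conjI) (auto simp: U profile_def)
  qed
qed

lemma compactin_abs_sigma_if_profile_closed:
  fixes K :: "'a::banach_lattice set"
  assumes bdd: "bounded K" and closed: "closed (profile ` K)"
  shows "compactin (abs_sigma UNIV) K"
proof -
  obtain R where R: "\<And>x. x \<in> K \<Longrightarrow> norm x \<le> R" using bdd unfolding bounded_iff by blast
  let ?box = "PiE UNIV (\<lambda>(f, a). {0 .. norm f * (R + norm a)}) :: (('a \<Rightarrow>\<^sub>L real) \<times> 'a \<Rightarrow> real) set"
  have "compactin (product_topology (\<lambda>_. euclidean) UNIV) ?box"
    unfolding compactin_PiE by auto
  then have "compact ?box" by (simp add: euclidean_product_topology)
  moreover have "profile ` K \<subseteq> ?box"
  proof -
    have "abs_pair f (x - a) \<le> norm f * (R + norm a)" if "x \<in> K" for x a f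
    proof -
      have "norm (x - a) \<le> R + norm a" using R[OF that] norm_triangle_ineq4[of x a] by linarith
      then have "norm f * norm (x - a) \<le> norm f * (R + norm a)" by (intro mult_left_mono) auto
      then show ?thesis using abs_pair_le_norm[of f "x - a"] by linarith
    qed
    then show ?thesis by (auto simp: profile_def abs_pair_nonneg)
  qed
  ultimately have compact: "compact (profile ` K)"
    using closed by (metis compact_Int_closed inf.absorb_iff2)
  show ?thesis
    unfolding compactin_def
  proof (intro conjI allI impI)
    show "K \<subseteq> topspace (abs_sigma UNIV)" by (simp add: topspace_abs_sigma)
    fix \<U> assume \<U>: "Ball \<U> (openin (abs_sigma UNIV)) \<and> K \<subseteq> \<Union> \<U>"
    then obtain V where V: "\<And>U. U \<in> \<U> \<Longrightarrow> open (V U) \<and> U = profile -` V U"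
      using openin_abs_sigma_profile by metis
    have "profile ` K \<subseteq> (\<Union>U\<in>\<U>. V U)" using V \<U> by fastforce
    with compact V obtain \<F> where \<F>: "\<F> \<subseteq> \<U>" "finite \<F>" "profile ` K \<subseteq> (\<Union>U\<in>\<F>. V U)"
      by (elim compactE_image) auto
    have "K \<subseteq> \<Union>\<F>"
    proof
      fix x assume "x \<in> K"
      then obtain U where "U \<in> \<F>" "profile x \<in> V U" using \<F>(3) by blast
      then show "x \<in> \<Union>\<F>" using V \<F>(1) by blast
    qed
    then show "\<exists>\<F>. finite \<F> \<and> \<F> \<subseteq> \<U> \<and> K \<subseteq> \<Union> \<F>" using \<F> by blast
  qed
qed

text \<open>
  A form general enough for every inequality that has to be carried over from profiles of points to
  limits of profiles; equal indices and zero coefficients specialise it.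
\<close>

lemma closure_image_relation:
  fixes \<phi> :: "'i \<Rightarrow> real"
  assumes "\<phi> \<in> closure (h ` K)" and "\<And>x. x \<in> K \<Longrightarrow> h x i \<le> c * h x j + d * h x k + r"
  shows "\<phi> i \<le> c * \<phi> j + d * \<phi> k + r"
proof -
  have "closed {\<phi> :: 'i \<Rightarrow> real. \<phi> i \<le> c * \<phi> j + d * \<phi> k + r}"
    by (intro closed_Collect_le continuous_intros continuous_on_product_coordinates)
  then have "closure (h ` K) \<subseteq> {\<phi>. \<phi> i \<le> c * \<phi> j + d * \<phi> k + r}"
    using assms(2) by (intro closure_minimal) auto
  then show ?thesis using assms(1) by blast
qed

lemma closure_image_approx:
  fixes \<phi> :: "'i \<Rightarrow> real"
  assumes "\<phi> \<in> closure (h ` K)" and "finite I" and "0 < e"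
  obtains x where "x \<in> K" "\<And>i. i \<in> I \<Longrightarrow> \<bar>h x i - \<phi> i\<bar> < e"
proof -
  let ?U = "{\<psi>. \<forall>i\<in>I. \<bar>\<psi> i - \<phi> i\<bar> < e}"
  have U: "?U = (\<Inter>i\<in>I. {\<psi>. \<bar>\<psi> i - \<phi> i\<bar> < e})" by auto
  have "open {\<psi>. \<bar>\<psi> i - \<phi> i\<bar> < e}" for i
    by (intro open_Collect_less continuous_intros continuous_on_product_coordinates)
  then have "open ?U" unfolding U by (intro open_INT assms(2) ballI)
  moreover have "\<phi> \<in> ?U" using assms(3) by simp
  ultimately have "?U \<inter> h ` K \<noteq> {}"
    using assms(1) open_Int_closure_eq_empty[of ?U "h ` K"] by blast
  then show ?thesis using that by blast
qed

text \<open>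
  The same coefficients work: the modulus of a convex combination of the \<open>s n - l\<close> is at most the
  convex combination of their moduli.  The index \<open>k\<close> records that only finitely many terms occur.
\<close>

lemma dominating_convex_combination:
  fixes s :: "nat \<Rightarrow> 'a::banach_lattice"
  assumes "v \<in> convex hull (range (\<lambda>n. \<bar>s n - l\<bar>))"
  shows "\<exists>k. \<exists>a\<in>convex hull (s ` {..<k}). \<bar>a - l\<bar> \<le> v"
proof -
  let ?D = "{v. \<exists>k. \<exists>a\<in>convex hull (s ` {..<k}). \<bar>a - l\<bar> \<le> v}"
  have "convex ?D"
  proof (rule convexI)
    fix v w and p q :: real
    assume vw: "v \<in> ?D" "w \<in> ?D" and pq: "0 \<le> p" "0 \<le> q" "p + q = 1"
    then obtain j a k b where a: "a \<in> convex hull (s ` {..<j})" "\<bar>a - l\<bar> \<le> v"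
      and b: "b \<in> convex hull (s ` {..<k})" "\<bar>b - l\<bar> \<le> w"
      by blast
    have "convex hull (s ` {..<j}) \<subseteq> convex hull (s ` {..<max j k})"
      "convex hull (s ` {..<k}) \<subseteq> convex hull (s ` {..<max j k})"
      by (intro hull_mono image_mono; simp)+
    then have ab: "p *\<^sub>R a + q *\<^sub>R b \<in> convex hull (s ` {..<max j k})"
      using a b pq by (intro convexD[OF convex_convex_hull]) auto
    have "p *\<^sub>R a + q *\<^sub>R b - l = p *\<^sub>R (a - l) + q *\<^sub>R (b - l)"
      using pq(3) by (simp add: algebra_simps flip: scaleR_add_left)
    then have "\<bar>p *\<^sub>R a + q *\<^sub>R b - l\<bar> \<le> \<bar>p *\<^sub>R (a - l)\<bar> + \<bar>q *\<^sub>R (b - l)\<bar>"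
      by (simp add: abs_triangle_ineq)
    also have "\<dots> \<le> p *\<^sub>R \<bar>a - l\<bar> + q *\<^sub>R \<bar>b - l\<bar>"
      by (intro add_mono abs_scaleR_nonneg pq)
    also have "\<dots> \<le> p *\<^sub>R v + q *\<^sub>R w"
      by (intro add_mono scaleR_left_mono a b pq)
    finally show "p *\<^sub>R v + q *\<^sub>R w \<in> ?D" using ab by blast
  qed
  moreover have "\<bar>s n - l\<bar> \<in> ?D" for n
    by (auto intro!: exI[of _ "Suc n"] bexI[of _ "s n"] hull_inc)
  ultimately have "convex hull (range (\<lambda>n. \<bar>s n - l\<bar>)) \<subseteq> ?D"
    by (intro hull_minimal) auto
  then show ?thesis using assms by blast
qed

lemma finite_net_convex_hull:
  fixes X :: "'a::real_normed_vector set"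
  assumes "finite X" "0 < e"
  obtains N where "finite N" "\<And>a. a \<in> convex hull X \<Longrightarrow> \<exists>b\<in>N. norm (a - b) < e"
proof -
  have "convex hull X \<subseteq> (\<Union>b\<in>convex hull X. ball b e)" using assms(2) by auto
  with finite_imp_compact_convex_hull[OF assms(1)]
  obtain N where N: "finite N" "convex hull X \<subseteq> (\<Union>b\<in>N. ball b e)"
    by (elim compactE_image) auto
  show ?thesis
  proof (rule that[OF N(1)])
    fix a assume "a \<in> convex hull X"
    then show "\<exists>b\<in>N. norm (a - b) < e" using N(2) by (fastforce simp: dist_norm norm_minus_commute)
  qed
qed

text \<open>
  The factor 2 replaces an attained supremum: a positive supremum is exceeded by twice some value,
  and if the supremum is 0 then all values are 0.
\<close>

lemma half_maximal_element:
  fixes h :: "'b \<Rightarrow> real"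
  assumes "S \<noteq> {}" and nonneg: "\<And>g. g \<in> S \<Longrightarrow> 0 \<le> h g" and bdd: "\<And>g. g \<in> S \<Longrightarrow> h g \<le> M"
  obtains m where "m \<in> S" "\<And>g. g \<in> S \<Longrightarrow> h g \<le> 2 * h m"
proof -
  let ?s = "SUP g\<in>S. h g"
  have upper: "h g \<le> ?s" if "g \<in> S" for g
    using that bdd by (intro cSUP_upper bdd_aboveI2) auto
  have "\<exists>m\<in>S. ?s \<le> 2 * h m"
  proof (cases "?s \<le> 0")
    case True
    then show ?thesis using assms(1) nonneg by fastforce
  next
    case False
    then obtain m where "m \<in> S" "?s / 2 < h m"
      using less_cSUP_iff[of S h "?s / 2"] assms(1) bdd by (auto simp: bdd_above_def)
    then show ?thesis by (intro bexI[of _ m]) auto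
  qed
  then show ?thesis using upper that by (meson order_trans)
qed

text \<open>
  Every element \<open>\<phi>\<close> of the closure inherits the triangle inequalities, so that it acts like the family
  of distances to an ideal point, and it is the profile of \<open>l\<close> as soon as \<open>\<phi> (g, l) = 0\<close> for all
  \<open>g\<close>.  Whitley's construction produces such an \<open>l\<close> in \<open>K\<close>.  Since a convex hull of finitely many
  points is totally bounded, finitely many coordinates per step suffice to treat all convex
  combinations of the points chosen so far, up to a vanishing error.
\<close>

lemma closed_profile_image:
  fixes B :: "('a::banach_lattice \<Rightarrow>\<^sub>L real) set" and K :: "'a set"
  assumes B: "abs_boundary B" and bdd: "bounded K"
    and seq: "\<And>s. range s \<subseteq> K \<Longrightarrow>
      \<exists>l\<in>K. \<exists>r :: nat \<Rightarrow> nat. strict_mono r \<and> (\<forall>f. (\<lambda>n. abs_pair f (s (r n) - l)) \<longlonglongrightarrow> 0)"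
  shows "closed (profile ` K)"
proof -
  obtain R where R: "\<And>x. x \<in> K \<Longrightarrow> norm x \<le> R" using bdd unfolding bounded_iff by blast
  have "\<phi> \<in> profile ` K" if \<phi>: "\<phi> \<in> closure (profile ` K)" for \<phi>
  proof -
    note rel = closure_image_relation[OF \<phi>]
    have nonneg: "0 \<le> \<phi> (f, a)" for f a
      using rel[of "(f, a)" 2 "(f, a)" 0 "(f, a)" 0] by (simp add: profile_def abs_pair_nonneg)
    have bound: "\<phi> (f, a) \<le> R + norm a" if "f \<in> cball 0 1" for f a
    proof -
      have "abs_pair f (x - a) \<le> R + norm a" if "x \<in> K" for x
        using abs_pair_le_norm_unit[OF \<open>f \<in> cball 0 1\<close>, of "x - a"] R[OF that]
          norm_triangle_ineq4[of x a] by linarith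
      then show ?thesis
        using rel[of "(f, a)" 0 "(f, a)" 0 "(f, a)" "R + norm a"] by (simp add: profile_def)
    qed
    have normalize: "\<exists>g\<in>cball 0 1. \<forall>a. \<phi> (f, a) \<le> norm f * \<phi> (g, a)" for f
    proof -
      obtain g where g: "g \<in> cball 0 1" "\<And>x. abs_pair f x \<le> norm f * abs_pair g x"
        using abs_pair_normalize by blast
      have "\<phi> (f, a) \<le> norm f * \<phi> (g, a)" for a
        using rel[of "(f, a)" "norm f" "(g, a)" 0 "(f, a)" 0] g(2) by (simp add: profile_def)
      with g(1) show ?thesis by blast
    qed
    have triangle: "\<phi> (f, a) \<le> \<phi> (f, b) + abs_pair f (b - a)" for f a b
    proof -
      have "abs_pair f (x - a) \<le> abs_pair f (x - b) + abs_pair f (b - a)" for x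
        using abs_pair_triangle[of f "x - b" "b - a"] by simp
      then show ?thesis
        using rel[of "(f, a)" 1 "(f, b)" 0 "(f, a)" "abs_pair f (b - a)"] by (simp add: profile_def)
    qed
    have reverse: "abs_pair f (b - a) \<le> \<phi> (f, a) + \<phi> (f, b)" for f a b
    proof -
      have "abs_pair f (b - a) \<le> abs_pair f (x - a) + abs_pair f (x - b)" for x
        using abs_pair_triangle[of f "b - x" "x - a"] abs_pair_minus_commute[of f b x] by simp
      then have "abs_pair f (x - a)
          \<le> 2 * abs_pair f (x - a) + 1 * abs_pair f (x - b) + - abs_pair f (b - a)" for x
        by (smt (verit))
      then show ?thesis
        using rel[of "(f, a)" 2 "(f, a)" 1 "(f, b)" "- abs_pair f (b - a)"] by (simp add: profile_def)
    qed

    \<comment> \<open>\<open>F a\<close> norms the difference of the ideal point and \<open>a\<close> up to a factor 2.\<close>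
    have "\<exists>m. m \<in> cball 0 1 \<and> (\<forall>g\<in>cball 0 1. \<phi> (g, a) \<le> 2 * \<phi> (m, a))" for a
      by (rule half_maximal_element[of "cball 0 1" "\<lambda>g. \<phi> (g, a)" "R + norm a"])
        (use nonneg bound in auto)
    then obtain F where F: "\<And>a. F a \<in> cball 0 1"
        "\<And>a g. g \<in> cball 0 1 \<Longrightarrow> \<phi> (g, a) \<le> 2 * \<phi> (F a, a)"
      by metis
    \<comment> \<open>Nets \<open>N X n\<close> of mesh \<open>1 / (n + 1)\<close> for the convex hulls of finite sets \<open>X\<close>.\<close>
    have "\<exists>N. finite X \<longrightarrow> finite N \<and> (\<forall>a\<in>convex hull X. \<exists>b\<in>N. norm (a - b) < inverse (real (Suc n)))"
      for X :: "'a set" and n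
      using finite_net_convex_hull[of X "inverse (real (Suc n))"] by (metis inverse_positive_iff_positive of_nat_0_less_iff zero_less_Suc)
    then obtain N where N: "\<And>(X :: 'a set) n. finite X \<Longrightarrow> finite (N X n)"
        "\<And>(X :: 'a set) n a. finite X \<Longrightarrow> a \<in> convex hull X \<Longrightarrow> \<exists>b\<in>N X n. norm (a - b) < inverse (real (Suc n))"
      by metis
    \<comment> \<open>The \<open>n\<close>-th point also respects the coordinates from all earlier steps \<open>k\<close>, so that the limit
      agrees with \<open>\<phi>\<close> at every coordinate ever selected.\<close>
    define Q where "Q x n y \<longleftrightarrow> y \<in> K \<and>
      (\<forall>k\<le>n. \<forall>b\<in>N (x ` {..<k}) k. \<bar>profile y (F b, b) - \<phi> (F b, b)\<bar> < inverse (real (Suc n)))"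
      for x n y
    have "\<exists>x. \<forall>n. Q x n (x n)"
    proof (rule dependent_wellorder_choice)
      fix y x x' and n :: nat
      assume "\<And>k. k < n \<Longrightarrow> x k = (x' k :: 'a)"
      then have "x ` {..<k} = x' ` {..<k}" if "k \<le> n" for k
        using that by (intro image_cong) auto
      then show "Q x n y = Q x' n y" by (simp add: Q_def)
    next
      fix x n
      let ?I = "\<Union>k\<le>n. (\<lambda>b. (F b, b)) ` N (x ` {..<k}) k"
      have fin: "finite ?I" by (simp add: N(1))
      have pos: "0 < inverse (real (Suc n))" by simp
      obtain y where "y \<in> K" "\<And>i. i \<in> ?I \<Longrightarrow> \<bar>profile y i - \<phi> i\<bar> < inverse (real (Suc n))"
        using closure_image_approx[OF \<phi> fin pos] by blast
      then show "\<exists>y. Q x n y" unfolding Q_def by (intro exI[of _ y]) blast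
    qed
    then obtain x where x: "\<And>n. x n \<in> K" "\<And>n k b. k \<le> n \<Longrightarrow> b \<in> N (x ` {..<k}) k \<Longrightarrow>
        \<bar>profile (x n) (F b, b) - \<phi> (F b, b)\<bar> < inverse (real (Suc n))"
      unfolding Q_def by blast
    obtain l and r :: "nat \<Rightarrow> nat" where l: "l \<in> K" and r: "strict_mono r"
      and lim: "\<And>f. (\<lambda>n. abs_pair f (x (r n) - l)) \<longlonglongrightarrow> 0"
      using seq[of x] x(1) by blast
    have net: "\<phi> (F b, b) \<le> dual_sup (l - b)" if b: "b \<in> N (x ` {..<k}) k" for k b
    proof -
      have "\<phi> (F b, b) \<le> 0 + abs_pair (F b) (l - b) + 0"
      proof (rule tendsto_lowerbound)
        show "(\<lambda>n. abs_pair (F b) (x (r n) - l) + abs_pair (F b) (l - b) + inverse (real (Suc n)))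
            \<longlonglongrightarrow> 0 + abs_pair (F b) (l - b) + 0"
          by (intro tendsto_add tendsto_const lim LIMSEQ_inverse_real_of_nat)
        show "\<forall>\<^sub>F n in sequentially. \<phi> (F b, b)
            \<le> abs_pair (F b) (x (r n) - l) + abs_pair (F b) (l - b) + inverse (real (Suc n))"
        proof (rule eventually_sequentiallyI)
          fix n assume "k \<le> n"
          then have "k \<le> r n" using seq_suble[OF r, of n] by linarith
          then have "\<phi> (F b, b) \<le> abs_pair (F b) (x (r n) - b) + inverse (real (Suc (r n)))"
            using x(2)[OF _ b, of "r n"] by (simp add: profile_def)
          moreover have "inverse (real (Suc (r n))) \<le> inverse (real (Suc n))"
            using seq_suble[OF r, of n] by (intro le_imp_inverse_le) auto
          moreover have "abs_pair (F b) (x (r n) - b) \<le> abs_pair (F b) (x (r n) - l) + abs_pair (F b) (l - b)"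
            using abs_pair_triangle[of "F b" "x (r n) - l" "l - b"] by simp
          ultimately show "\<phi> (F b, b)
            \<le> abs_pair (F b) (x (r n) - l) + abs_pair (F b) (l - b) + inverse (real (Suc n))" by linarith
        qed
      qed simp
      then show ?thesis using abs_pair_le_dual_sup[OF F(1)[of b], of "l - b"] by linarith
    qed
    have "\<phi> (g, l) \<le> 0" if g: "g \<in> cball 0 1" for g
    proof (rule field_le_epsilon)
      fix e' :: real assume "0 < e'"
      \<comment> \<open>The final estimate collects \<open>4 e\<close> from \<open>\<phi> (g, b)\<close> and \<open>2 e\<close> from the distance of \<open>b\<close> to \<open>l\<close>.\<close>
      define e where "e = e' / 6"
      have e: "0 < e" using \<open>0 < e'\<close> by (simp add: e_def)
      have bounded: "bounded (range (\<lambda>n. x (r n) - l))"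
      proof (rule boundedI)
        show "norm y \<le> R + norm l" if "y \<in> range (\<lambda>n. x (r n) - l)" for y
          using that R[OF x(1)] by (auto intro: order_trans[OF norm_triangle_ineq4])
      qed
      obtain v where v: "v \<in> convex hull (range (\<lambda>n. \<bar>x (r n) - l\<bar>))" "dual_sup v < e"
        by (rule abs_boundary_small_convex_combination[OF B bounded lim e])
      obtain j a where a: "a \<in> convex hull ((\<lambda>n. x (r n)) ` {..<j})" "\<bar>a - l\<bar> \<le> v"
        using dominating_convex_combination[OF v(1)] by blast
      have "\<bar>a - l\<bar> \<le> \<bar>v\<bar>" using a(2) abs_ge_self by (rule order_trans)
      then have al: "dual_sup (a - l) < e" using dual_sup_mono v(2) by (meson le_less_trans)
      obtain k0 where k0: "inverse (real (Suc k0)) < e" using reals_Archimedean[OF e] by blast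
      define k where "k = max k0 (r j)"
      have "inverse (real (Suc k)) \<le> inverse (real (Suc k0))"
        by (intro le_imp_inverse_le) (auto simp: k_def)
      with k0 have k: "inverse (real (Suc k)) < e" by linarith
      have "(\<lambda>n. x (r n)) ` {..<j} \<subseteq> x ` {..<k}"
        using strict_monoD[OF r] unfolding k_def by (fastforce simp: less_max_iff_disj)
      then have "a \<in> convex hull (x ` {..<k})" using a(1) hull_mono by blast
      then obtain b where b: "b \<in> N (x ` {..<k}) k" "norm (a - b) < inverse (real (Suc k))"
        using N(2)[of "x ` {..<k}"] by blast
      have ab: "dual_sup (a - b) < e" using dual_sup_le_norm[of "a - b"] b(2) k by linarith
      have "dual_sup (l - a) = dual_sup (a - l)" by (simp add: dual_sup_def abs_minus_commute)
      then have lb: "dual_sup (l - b) < 2 * e"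
        using dual_sup_triangle[of "l - a" "a - b"] ab al by simp
      have "\<phi> (g, b) < 4 * e" using F(2)[OF g, of b] net[OF b(1)] lb by linarith
      moreover have "abs_pair g (b - l) < 2 * e"
        using abs_pair_le_dual_sup[OF g, of "l - b"] lb abs_pair_minus_commute[of g b l] by linarith
      ultimately show "\<phi> (g, l) \<le> 0 + e'" using triangle[of g l b] by (simp add: e_def)
    qed
    then have "\<phi> (f, l) \<le> 0" for f
      using normalize[of f] nonneg by (metis mult_zero_right order_antisym)
    then have "\<phi> (f, l) = 0" for f using nonneg by (simp add: order_antisym)
    then have "\<phi> (f, a) = abs_pair f (l - a)" for f a
      using triangle[of f a l] reverse[of f l a] by simp
    then have "\<phi> = profile l" by (auto simp: profile_def)
    with l show ?thesis by blast
  qed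
  then have "closure (profile ` K) \<subseteq> profile ` K" by blast
  then show ?thesis by (metis closure_subset closed_closure subset_antisym)
qed

theorem theorem2p7:
  fixes B :: "('a::banach_lattice \<Rightarrow>\<^sub>L real) set" and K :: "'a set"
  assumes "abs_boundary B"
    and "bounded K"
    and "seq_compactin (abs_sigma B) K"
  shows "seq_compactin (abs_sigma UNIV) K \<and>
    (separable_space (euclidean :: 'a topology) \<or>
       compactin abs_weak_star (cball 0 1 :: (('a \<Rightarrow>\<^sub>L real) \<Rightarrow>\<^sub>L real) set)
     \<longrightarrow> compactin (abs_sigma UNIV) K)"
proof -
  have "B \<noteq> {}" using assms(1) unfolding abs_boundary_def by blast
  have seq: "\<exists>l\<in>K. \<exists>r :: nat \<Rightarrow> nat. strict_mono r \<and> (\<forall>f. (\<lambda>n. abs_pair f (s (r n) - l)) \<longlonglongrightarrow> 0)"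
    if s: "range s \<subseteq> K" for s
  proof -
    obtain l and r :: "nat \<Rightarrow> nat" where l: "l \<in> K" "strict_mono r"
        "limitin (abs_sigma B) (s \<circ> r) l sequentially"
      using assms(3) s unfolding seq_compactin_def by blast
    then have null: "(\<lambda>n. abs_pair f (s (r n) - l)) \<longlonglongrightarrow> 0" if "f \<in> B" for f
      using that by (simp add: limitin_abs_sigma[OF \<open>B \<noteq> {}\<close>])
    have bounded: "bounded (range (\<lambda>n. s (r n) - l))"
    proof -
      have "range (\<lambda>n. s (r n) - l) \<subseteq> (\<lambda>y. y - l) ` K" using s by auto
      then show ?thesis by (rule bounded_subset[OF bounded_translation_minus[OF assms(2)]])
    qed
    have "(\<lambda>n. abs_pair f (s (r n) - l)) \<longlonglongrightarrow> 0" for f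
      by (rule abs_boundary_null_sequence[OF assms(1) bounded null])
    with l show ?thesis by blast
  qed
  have "seq_compactin (abs_sigma UNIV) K"
    unfolding seq_compactin_def
    using seq by (simp add: topspace_abs_sigma limitin_abs_sigma)
  moreover have "compactin (abs_sigma UNIV) K"
    by (rule compactin_abs_sigma_if_profile_closed[OF assms(2)
          closed_profile_image[OF assms(1,2) seq]])
  ultimately show ?thesis by blast
qed

end
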